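(* For $p>1$ and $\alpha>0$ let $v_\alpha$ be the solution with $\Vert v_\alpha\Vert_\infty=\alpha$ of $-v''=\mu(v^p+v\sin^2 v)$ in $(0,1)$, $v>0$ in $(0,1)$, $v(0)=v(1)=0$ (with the corresponding $\mu=\mu(\alpha)>0$). With the constants $G_0,G_1,G_2,G_4$ defined in the context: (i) Let $1<p<2$. Then as $\alpha\to\infty$, $$\Vert v_\alpha'\Vert_2^2=4\alpha^2\big\{G_0+G_1\alpha^{1-p}+G_4\alpha^{2(1-p)}+G_2\alpha^{-p}+o(\alpha^{2(1-p)})\big\}.$$ (ii) Let $p=2$. Then as $\alpha\to\infty$, $$\Vert v_\alpha'\Vert_2^2=4\alpha^2\big\{G_0+G_1\alpha^{-1}+(G_2+G_4)\alpha^{-2}+o(\alpha^{-2})\big\}.$$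
   Context: Consider, for $p>1$ and a parameter $\mu>0$, the problem $-v''(x)=\mu(v(x)^p+v(x)\sin^2v(x))$ for $x\in I:=(0,1)$, $v(x)>0$ for $x\in I$, $v(0)=v(1)=0$. It is known that for every $\alpha>0$ there is a unique pair $(\mu(\alpha),v_\alpha)\in\mathbb{R}_+\times C^2(\bar I)$ solving it with $\Vert v_\alpha\Vert_\infty=\alpha$. $\Vert\cdot\Vert_2$ is the usual $L^2(I)$-norm. Constants (some depend on $\alpha$): $C_{0,p}:=\int_0^1\frac{1}{\sqrt{1-s^{p+1}}}ds$, $C_1:=-\frac{p+1}{8}\int_0^1\frac{1-s^2}{(1-s^{p+1})^{3/2}}ds$, $C_{11}:=\frac{2}{p+1}\int_0^{\pi/2}\cos(2\alpha\sin^{2/(p+1)}\theta)\sin^{(3-p)/(p+1)}\theta\,d\theta$, $C_{12}:=\frac{p-1}{2(p+1)}\int_0^{\pi/2}(\sin2\alpha-\sin(2\alpha\sin^{2/(p+1)}\theta))\sin^{(1-p)/(p+1)}\theta\,d\theta+\frac{p+1}{4}\int_0^1\frac{1-s}{(1-s^{p+1})^{3/2}}\sin(2\alpha s)ds$, $C_{21}:=-\frac{1}{p+1}\int_0^{\pi/2}\sin(2\alpha\sin^{2/(p+1)}\theta)\sin^{(3-p)/(p+1)}\theta\,d\theta$, $C_2:=\frac{3(p+1)^2}{128}\int_0^1\frac{(1-s^2)^2}{(1-s^{p+1})^{5/2}}ds$, $C_3:=-\frac{3}{32}(p+1)^2\int_0^1\left(\int_0^s\frac{1-y^2}{(1-y^{p+1})^{5/2}}dy\right)\cos(2\alpha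 s)ds$, $E_{0,p}:=\int_0^1\sqrt{1-s^{p+1}}ds$, $E_1:=\frac{p+1}{8}\int_0^1\frac{1-s^2}{\sqrt{1-s^{p+1}}}ds$, $E_2:=-\frac14\int_0^{\pi/2}\{\sin2\alpha-\sin^{2/(p+1)}\theta\sin(2\alpha\sin^{2/(p+1)}\theta)\}\sin^{(1-p)/(p+1)}\theta\,d\theta$, $E_4:=-\frac{(p+1)^2}{128}\int_0^1\frac{(1-s^2)^2}{(1-s^{p+1})^{3/2}}ds$, $G_0:=C_{0,p}E_{0,p}$, $G_1:=C_{0,p}E_1+(C_1+\frac12C_{11})E_{0,p}$, $G_2:=\frac12(C_{12}+C_{21})E_{0,p}+C_{0,p}E_2$, $G_4:=(C_2+C_3)E_{0,p}+C_{0,p}E_4+(C_1+\frac12C_{11})E_1$. *)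

theory Defs
  imports "HOL-Analysis.Analysis" "HOL-Library.Landau_Symbols"
begin

text \<open>
  Functions on the closed unit interval are represented by total functions on the reals whose
  values outside \<open>{0..1}\<close> are irrelevant.  Hence derivatives at the end points are one-sided
  (\<open>at x within {0..1}\<close>), and \<^const>\<open>deriv\<close> is only ever used at interior points.
\<close>

definition C2_closed_unit_interval :: "(real \<Rightarrow> real) \<Rightarrow> bool" where
  "C2_closed_unit_interval f \<longleftrightarrow>
     (\<exists>f' f''. (\<forall>x\<in>{0..1}. (f has_real_derivative f' x) (at x within {0..1})) \<and>
               (\<forall>x\<in>{0..1}. (f' has_real_derivative f'' x) (at x within {0..1})) \<and>
               continuous_on {0..1} f'')"

definition sup_norm :: "(real \<Rightarrow> real) \<Rightarrow> real" where
  "sup_norm f = (SUP x\<in>{0..1}. \<bar>f x\<bar>)"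

definition L2_norm :: "(real \<Rightarrow> real) \<Rightarrow> real" where
  "L2_norm f = sqrt (LBINT x:{0<..<1}. (f x)\<^sup>2)"

definition bvp_solution :: "real \<Rightarrow> real \<Rightarrow> (real \<Rightarrow> real) \<Rightarrow> bool" where
  "bvp_solution p \<mu> v \<longleftrightarrow>
     \<mu> > 0 \<and> C2_closed_unit_interval v \<and>
     (\<forall>x\<in>{0<..<1}. - deriv (deriv v) x = \<mu> * (v x powr p + v x * (sin (v x))\<^sup>2)) \<and>
     (\<forall>x\<in>{0<..<1}. v x > 0) \<and> v 0 = 0 \<and> v 1 = 0"

text \<open>
  All the integrals below converge absolutely for \<open>p > 1\<close>, as Lebesgue integrals over the open
  interval, although some of the integrands are unbounded at an end point.
\<close>

definition C0 :: "real \<Rightarrow> real" where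
  "C0 p = (LBINT s:{0<..<1}. 1 / sqrt (1 - s powr (p + 1)))"

definition C1 :: "real \<Rightarrow> real" where
  "C1 p = - ((p + 1) / 8) *
     (LBINT s:{0<..<1}. (1 - s\<^sup>2) / (1 - s powr (p + 1)) powr (3/2))"

definition C11 :: "real \<Rightarrow> real \<Rightarrow> real" where
  "C11 p \<alpha> = 2 / (p + 1) *
     (LBINT \<theta>:{0<..<pi/2}.
        cos (2 * \<alpha> * sin \<theta> powr (2 / (p + 1))) * sin \<theta> powr ((3 - p) / (p + 1)))"

definition C12 :: "real \<Rightarrow> real \<Rightarrow> real" where
  "C12 p \<alpha> = (p - 1) / (2 * (p + 1)) *
     (LBINT \<theta>:{0<..<pi/2}.
        (sin (2 * \<alpha>) - sin (2 * \<alpha> * sin \<theta> powr (2 / (p + 1)))) *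
        sin \<theta> powr ((1 - p) / (p + 1)))
     + (p + 1) / 4 *
     (LBINT s:{0<..<1}. (1 - s) / (1 - s powr (p + 1)) powr (3/2) * sin (2 * \<alpha> * s))"

definition C21 :: "real \<Rightarrow> real \<Rightarrow> real" where
  "C21 p \<alpha> = - (1 / (p + 1)) *
     (LBINT \<theta>:{0<..<pi/2}.
        sin (2 * \<alpha> * sin \<theta> powr (2 / (p + 1))) * sin \<theta> powr ((3 - p) / (p + 1)))"

definition C2 :: "real \<Rightarrow> real" where
  "C2 p = 3 * (p + 1)\<^sup>2 / 128 *
     (LBINT s:{0<..<1}. (1 - s\<^sup>2)\<^sup>2 / (1 - s powr (p + 1)) powr (5/2))"

definition C3 :: "real \<Rightarrow> real \<Rightarrow> real" where
  "C3 p \<alpha> = - (3/32) * (p + 1)\<^sup>2 *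
     (LBINT s:{0<..<1}.
        (LBINT y:{0<..<s}. (1 - y\<^sup>2) / (1 - y powr (p + 1)) powr (5/2)) * cos (2 * \<alpha> * s))"

definition E0 :: "real \<Rightarrow> real" where
  "E0 p = (LBINT s:{0<..<1}. sqrt (1 - s powr (p + 1)))"

definition E1 :: "real \<Rightarrow> real" where
  "E1 p = (p + 1) / 8 *
     (LBINT s:{0<..<1}. (1 - s\<^sup>2) / sqrt (1 - s powr (p + 1)))"

definition E2 :: "real \<Rightarrow> real \<Rightarrow> real" where
  "E2 p \<alpha> = - (1/4) *
     (LBINT \<theta>:{0<..<pi/2}.
        (sin (2 * \<alpha>) -
           sin \<theta> powr (2 / (p + 1)) * sin (2 * \<alpha> * sin \<theta> powr (2 / (p + 1)))) *
        sin \<theta> powr ((1 - p) / (p + 1)))"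

definition E4 :: "real \<Rightarrow> real" where
  "E4 p = - ((p + 1)\<^sup>2 / 128) *
     (LBINT s:{0<..<1}. (1 - s\<^sup>2)\<^sup>2 / (1 - s powr (p + 1)) powr (3/2))"

definition G0 :: "real \<Rightarrow> real" where
  "G0 p = C0 p * E0 p"

definition G1 :: "real \<Rightarrow> real \<Rightarrow> real" where
  "G1 p \<alpha> = C0 p * E1 p + (C1 p + 1/2 * C11 p \<alpha>) * E0 p"

definition G2 :: "real \<Rightarrow> real \<Rightarrow> real" where
  "G2 p \<alpha> = 1/2 * (C12 p \<alpha> + C21 p \<alpha>) * E0 p + C0 p * E2 p \<alpha>"

definition G4 :: "real \<Rightarrow> real \<Rightarrow> real" where
  "G4 p \<alpha> = (C2 p + C3 p \<alpha>) * E0 p + C0 p * E4 p + (C1 p + 1/2 * C11 p \<alpha>) * E1 p"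

end

theory Submission
  imports Defs
begin

text \<open>
  The equation conserves the energy \<open>v'\<^sup>2 / 2 + \<mu> F v\<close>, where \<open>F\<close> is an antiderivative of the
  nonlinearity.  On each side of its maximum point the solution is therefore a monotone solution of
  \<open>v'\<^sup>2 = 2 \<mu> (F \<alpha> - F v)\<close>, and substituting \<open>v = \<alpha> s\<close> in the length of the interval and in the
  Dirichlet integral gives, after elimination of \<open>\<mu>\<close>, the exact formula (\<open>gradient_norm_eq_product\<close>)
  that the squared norm is \<open>4 \<alpha>\<^sup>2\<close> times the product of the integrals over \<open>0 < s < 1\<close> of \<open>1 / sqrt R\<close>
  and \<open>sqrt R\<close>.  Here \<open>R\<close> is \<open>F \<alpha> - F (\<alpha> s)\<close> divided by \<open>\<alpha>\<^bsup>p+1\<^esup> / (p + 1)\<close>; it is the sum of the gap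
  \<open>H = 1 - s\<^bsup>p+1\<^esup>\<close> and of \<open>(p + 1) / 4\<close> times
  \<open>\<alpha>\<^bsup>1-p\<^esup> (1 - s\<^sup>2) - \<alpha>\<^bsup>-p\<^esup> (sin 2\<alpha> - s sin 2\<alpha>s) - \<alpha>\<^bsup>-p-1\<^esup> (cos 2\<alpha> - cos 2\<alpha>s) / 2\<close>.

  All three perturbing terms are \<open>O(\<alpha>\<^bsup>1-p\<^esup> (1 - s))\<close>, and \<open>H \<ge> 1 - s\<close>.  Their quotient by \<open>H\<close> is thus
  uniformly \<open>O(\<alpha>\<^bsup>1-p\<^esup>)\<close>, so that \<open>R\<^bsup>-1/2\<^esup>\<close> and \<open>R\<^bsup>1/2\<^esup>\<close> may be expanded to second order under the integral
  sign with an error \<open>O(\<alpha>\<^bsup>3(1-p)\<^esup>)\<close> (\<open>radicand_power_integral\<close>).  In the quadratic term the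
  oscillating differences do not contribute to the order \<open>\<alpha>\<^bsup>2(1-p)\<^esup>\<close>: they are at most a constant times
  \<open>min 1 (\<alpha> (1 - s))\<close>, and interpolating between the two bounds saves a power of \<open>\<alpha>\<close>.  In the linear terms
  they do contribute.  For \<open>sqrt R\<close> this gives \<open>E2\<close> directly; for \<open>1 / sqrt R\<close> an integration by parts
  (\<open>gap_integration_by_parts\<close>) that lowers the singular power \<open>H\<^bsup>-3/2\<^esup>\<close> to \<open>H\<^bsup>-1/2\<^esup>\<close> produces a factor \<open>\<alpha>\<close>,
  and this is how \<open>C11\<close>, \<open>C12\<close> and \<open>C21\<close> arise (\<open>linear_term_of_period\<close>).

  To recognise the coefficients, the integrals over \<open>\<theta>\<close> are brought to the variable \<open>s\<close> by
  \<open>sin \<theta> = s powr ((p + 1) / 2)\<close>.  The double integral \<open>C3\<close> tends to 0 as \<open>\<alpha>\<close> grows (\<open>C3_bound\<close>), so its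
  presence in \<open>G4\<close> is consistent with a quadratic term that contains \<open>C2\<close> alone.  The other oscillating
  coefficients are bounded, and multiplying the two expansions gives the theorem
  (\<open>product_expansion\<close>).
\<close>

section \<open>Reduction to a product of two integrals\<close>

text \<open>
  Along an increasing branch from 0 to 1 of \<open>g' = \<kappa> sqrt (R g)\<close>, the substitution \<open>s = g x\<close> turns
  the travelling time into the integral of \<open>1 / sqrt R\<close> and the Dirichlet energy into that of \<open>sqrt R\<close>.
  The equation is assumed on the open interval only: in the application \<open>R\<close> vanishes at 1, and
  \<open>1 / sqrt R\<close> is singular there.
\<close>

lemma monotone_orbit_integrals:
  fixes g g' R :: "real \<Rightarrow> real"
  assumes "a < b" and "\<kappa> > 0"
    and deriv: "\<And>x. x \<in> {a<..<b} \<Longrightarrow> DERIV g x :> g' x"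
    and g_cont: "continuous_on {a..b} g" and g'_cont: "continuous_on {a..b} g'"
    and g'_nonneg: "\<And>x. x \<in> {a..b} \<Longrightarrow> g' x \<ge> 0"
    and ends: "g a = 0" "g b = 1"
    and range: "\<And>x. x \<in> {a<..<b} \<Longrightarrow> g x \<in> {0<..<1}"
    and ode: "\<And>x. x \<in> {a<..<b} \<Longrightarrow> g' x = \<kappa> * sqrt (R (g x))"
    and R_cont: "\<And>s. s \<in> {0<..<1} \<Longrightarrow> isCont R s"
    and R_pos: "\<And>s. s \<in> {0<..<1} \<Longrightarrow> R s > 0"
  shows "(LBINT s:{0<..<1}. 1 / sqrt (R s)) = \<kappa> * (b - a)"
    and "(LBINT x:{a<..<b}. (g' x)\<^sup>2) = \<kappa> * (LBINT s:{0<..<1}. sqrt (R s))"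
proof -
  have lim0: "((ereal \<circ> g \<circ> real_of_ereal) \<longlongrightarrow> 0) (at_right (ereal a))"
    and lim1: "((ereal \<circ> g \<circ> real_of_ereal) \<longlongrightarrow> 1) (at_left (ereal b))"
  proof -
    have "(g \<longlongrightarrow> 0) (at_right a)" "(g \<longlongrightarrow> 1) (at_left b)"
      using continuous_on_Icc_at_rightD[OF g_cont \<open>a < b\<close>]
        continuous_on_Icc_at_leftD[OF g_cont \<open>a < b\<close>] ends by auto
    then show "((ereal \<circ> g \<circ> real_of_ereal) \<longlongrightarrow> 0) (at_right (ereal a))"
      and "((ereal \<circ> g \<circ> real_of_ereal) \<longlongrightarrow> 1) (at_left (ereal b))"
      unfolding ereal_tendsto_simps by (auto simp: o_def zero_ereal_def one_ereal_def)
  qed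
  have isCont_g': "isCont g' x" if "x \<in> {a<..<b}" for x
    using that g'_cont continuous_on_interior[of "{a..b}" g' x] by simp
  have R_nz: "R s \<noteq> 0" if "s \<in> {0<..<1}" for s
    using R_pos[OF that] by simp
  have R_g: "R (g x) \<noteq> 0" if "x \<in> {a<..<b}" for x
    using R_nz range that by blast
  have subst: "(LBINT s:{0<..<1}. f s) = (LBINT x:{a<..<b}. f (g x) * g' x)"
    if "\<And>s. s \<in> {0<..<1} \<Longrightarrow> isCont f s" "\<And>s. s \<in> {0<..<1} \<Longrightarrow> 0 \<le> f s"
      "set_integrable lborel {a<..<b} (\<lambda>x. f (g x) * g' x)" for f :: "real \<Rightarrow> real"
  proof -
    have "(LBINT s=0..1. f s) = (LBINT x=ereal a..ereal b. f (g x) * g' x)"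
      by (rule interval_integral_substitution_nonneg(2)[where g' = g'])
        (use assms that lim0 lim1 isCont_g' in auto)
    then show ?thesis
      using \<open>a < b\<close> by (simp add: interval_integral_Ioo zero_ereal_def one_ereal_def)
  qed
  have "(LBINT s:{0<..<1}. 1 / sqrt (R s)) = (LBINT x:{a<..<b}. 1 / sqrt (R (g x)) * g' x)"
  proof (rule subst)
    have "set_integrable lborel {a<..<b} (\<lambda>x. 1 / sqrt (R (g x)) * g' x)
        \<longleftrightarrow> set_integrable lborel {a<..<b} (\<lambda>x. \<kappa>)"
      by (intro set_integrable_cong) (auto simp: ode R_g)
    then show "set_integrable lborel {a<..<b} (\<lambda>x. 1 / sqrt (R (g x)) * g' x)"
      using \<open>a < b\<close> by (simp add: set_integrable_def integrable_indicator_iff)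
  qed (use R_cont R_pos R_nz in \<open>auto intro!: continuous_intros simp: less_imp_le\<close>)
  also have "\<dots> = (LBINT x:{a<..<b}. \<kappa>)"
    by (intro set_lebesgue_integral_cong) (auto simp: ode R_g)
  also have "\<dots> = \<kappa> * (b - a)"
    using \<open>a < b\<close> by (simp add: set_lebesgue_integral_def)
  finally show "(LBINT s:{0<..<1}. 1 / sqrt (R s)) = \<kappa> * (b - a)" .
  have g'_sq: "sqrt (R (g x)) * g' x = (g' x)\<^sup>2 / \<kappa>" if "x \<in> {a<..<b}" for x
    using that \<open>\<kappa> > 0\<close> by (simp add: ode power2_eq_square)
  have "set_integrable lborel {a..b} (\<lambda>x. (g' x)\<^sup>2 / \<kappa>)"
    using g'_cont by (intro borel_integrable_atLeastAtMost' continuous_intros) (use \<open>\<kappa> > 0\<close> in auto)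
  then have "set_integrable lborel {a<..<b} (\<lambda>x. (g' x)\<^sup>2 / \<kappa>)"
    by (rule set_integrable_subset) auto
  then have "set_integrable lborel {a<..<b} (\<lambda>x. sqrt (R (g x)) * g' x)"
    using g'_sq by (subst set_integrable_cong[OF refl refl]) auto
  then have "(LBINT s:{0<..<1}. sqrt (R s)) = (LBINT x:{a<..<b}. sqrt (R (g x)) * g' x)"
    using R_cont R_pos by (intro subst) (auto intro!: continuous_intros simp: less_imp_le)
  also have "\<dots> = (LBINT x:{a<..<b}. (g' x)\<^sup>2 / \<kappa>)"
    using g'_sq by (intro set_lebesgue_integral_cong) auto
  finally show "(LBINT x:{a<..<b}. (g' x)\<^sup>2) = \<kappa> * (LBINT s:{0<..<1}. sqrt (R s))"
    using \<open>\<kappa> > 0\<close> by simp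
qed

text \<open>
  An antiderivative of the nonlinearity \<open>t\<^sup>p + t sin\<^sup>2 t\<close> on \<open>t > 0\<close>, so that \<open>v'\<^sup>2 / 2 + \<mu> potential p v\<close> is the conserved energy.
\<close>

definition potential :: "real \<Rightarrow> real \<Rightarrow> real" where
  "potential p t = t powr (p + 1) / (p + 1) + t\<^sup>2 / 4 - t * sin (2 * t) / 4 - cos (2 * t) / 8"

text \<open>
  The potential difference between height \<open>\<alpha>\<close> and height \<open>\<alpha> s\<close>, normalised so that its leading part
  for large \<open>\<alpha>\<close> is \<open>1 - s\<^bsup>p+1\<^esup>\<close>: the rescaled solution \<open>v / \<alpha>\<close> moves along a monotone half with
  speed proportional to the square root of this function.
\<close>

definition radicand :: "real \<Rightarrow> real \<Rightarrow> real \<Rightarrow> real" where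
  "radicand p \<alpha> s = (p + 1) / \<alpha> powr (p + 1) * (potential p \<alpha> - potential p (\<alpha> * s))"

lemma DERIV_potential:
  assumes "p > 1" and "t > 0"
  shows "DERIV (potential p) t :> t powr p + t * (sin t)\<^sup>2"
proof -
  have "DERIV (\<lambda>t. t powr (p + 1) / (p + 1)) t :> t powr p"
    using assms by (auto intro!: derivative_eq_intros)
  moreover have "DERIV (\<lambda>t. t\<^sup>2 / 4 - t * sin (2 * t) / 4 - cos (2 * t) / 8) t :>
      t / 2 - (sin (2 * t) + t * (2 * cos (2 * t))) / 4 + sin (2 * t) / 4"
    by (auto intro!: derivative_eq_intros simp: field_simps)
  ultimately have "DERIV (potential p) t :>
      t powr p + (t / 2 - (sin (2 * t) + t * (2 * cos (2 * t))) / 4 + sin (2 * t) / 4)"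
    unfolding potential_def by (auto dest: DERIV_add simp: algebra_simps)
  also have "t powr p + (t / 2 - (sin (2 * t) + t * (2 * cos (2 * t))) / 4 + sin (2 * t) / 4)
      = t powr p + t * (sin t)\<^sup>2"
    unfolding cos_double_sin by (simp add: field_simps)
  finally show ?thesis .
qed

lemma isCont_radicand:
  assumes "p > 1" and "\<alpha> > 0" and "s > 0"
  shows "isCont (radicand p \<alpha>) s"
proof -
  have "isCont (\<lambda>s. potential p (\<alpha> * s)) s"
    using assms DERIV_isCont[OF DERIV_potential[of p "\<alpha> * s"]]
    by (intro isCont_o2[where f = "\<lambda>s. \<alpha> * s" and g = "potential p"]) auto
  then show ?thesis
    unfolding radicand_def by (intro continuous_intros)
qed

lemma radicand_pos:
  assumes "p > 1" and "\<alpha> > 0" and "s \<in> {0<..<1}"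
  shows "radicand p \<alpha> s > 0"
proof -
  have "potential p (\<alpha> * s) < potential p \<alpha>"
  proof (rule DERIV_pos_imp_increasing[of _ _ "potential p"])
    show "\<alpha> * s < \<alpha>" using assms by simp
    show "\<exists>y. DERIV (potential p) x :> y \<and> y > 0" if "\<alpha> * s \<le> x" "x \<le> \<alpha>" for x
    proof -
      have "0 < \<alpha> * s" using assms by simp
      then have "x > 0" using that by linarith
      then show ?thesis using DERIV_potential[OF \<open>p > 1\<close>, of x]
        by (intro exI[of _ "x powr p + x * (sin x)\<^sup>2"]) (auto intro!: add_pos_nonneg)
    qed
  qed
  then show ?thesis using assms by (simp add: radicand_def)
qed

text \<open>
  The solution is strictly concave, so it rises to a single maximum point \<open>m\<close> and falls afterwards;
  energy conservation makes each half, after reflecting the second one, a monotone branch of the same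
  first order equation.  The travelling times \<open>m\<close> and \<open>1 - m\<close> are both equal to the first integral
  divided by \<open>\<kappa>\<close>, which determines \<open>\<kappa>\<close> (and so the eigenvalue \<open>\<mu>\<close>) in terms of \<open>\<alpha>\<close>;
  eliminating \<open>\<kappa>\<close> leaves the product.
\<close>

lemma gradient_norm_eq_product:
  assumes "p > 1" and "\<alpha> > 0" and sol: "bvp_solution p \<mu> v" and norm: "sup_norm v = \<alpha>"
  shows "(L2_norm (deriv v))\<^sup>2 = 4 * \<alpha>\<^sup>2 *
    ((LBINT s:{0<..<1}. 1 / sqrt (radicand p \<alpha> s)) * (LBINT s:{0<..<1}. sqrt (radicand p \<alpha> s)))"
proof -
  have "\<mu> > 0" and v_pos: "\<And>x. x \<in> {0<..<1} \<Longrightarrow> v x > 0" and v0: "v 0 = 0" and v1: "v 1 = 0"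
    and eqn: "\<And>x. x \<in> {0<..<1} \<Longrightarrow> - deriv (deriv v) x = \<mu> * (v x powr p + v x * (sin (v x))\<^sup>2)"
    using sol unfolding bvp_solution_def by auto
  obtain v' v'' where
      v': "\<And>x. x \<in> {0..1} \<Longrightarrow> (v has_real_derivative v' x) (at x within {0..1})"
    and v'': "\<And>x. x \<in> {0..1} \<Longrightarrow> (v' has_real_derivative v'' x) (at x within {0..1})"
    using sol unfolding bvp_solution_def C2_closed_unit_interval_def by blast
  have Dv: "DERIV v x :> v' x" and Dv': "DERIV v' x :> v'' x" if "x \<in> {0<..<1}" for x
    using that v'[of x] v''[of x] by (simp_all add: at_within_Icc_at)
  have contv: "continuous_on {0..1} v" and contv': "continuous_on {0..1} v'"
    using v' v'' by (blast intro: has_real_derivative_imp_continuous_on DERIV_continuous_on)+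
  have deriv_v: "deriv v x = v' x" if "x \<in> {0<..<1}" for x
    using Dv[OF that] by (rule DERIV_imp_deriv)
  have v''_eq: "v'' x = - (\<mu> * (v x powr p + v x * (sin (v x))\<^sup>2))" if x: "x \<in> {0<..<1}" for x
  proof -
    have "DERIV (deriv v) x :> v'' x"
      by (rule has_field_derivative_transform_within_open[OF Dv'[OF x], of "{0<..<1}"])
        (use x deriv_v in auto)
    then show ?thesis using eqn[OF x] by (simp add: DERIV_imp_deriv)
  qed
  have v''_neg: "v'' x < 0" if "x \<in> {0<..<1}" for x
    using v_pos[OF that] \<open>\<mu> > 0\<close> v''_eq[OF that]
    by (auto intro!: mult_pos_pos add_pos_nonneg)
  obtain m where m: "m \<in> {0..1}" and max: "\<And>x. x \<in> {0..1} \<Longrightarrow> v x \<le> v m"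
    using continuous_attains_sup[of "{0..1}" v] contv by auto
  have abs_v: "\<bar>v x\<bar> = v x" if "x \<in> {0..1}" for x
    using that v_pos[of x] v0 v1 by (cases "x = 0 \<or> x = 1") auto
  have "sup_norm v = v m"
    unfolding sup_norm_def using m max abs_v
    by (intro cSup_eq_maximum) (auto intro!: image_eqI[of _ _ m])
  then have vm: "v m = \<alpha>" using norm by simp
  then have m01: "m \<in> {0<..<1}" using m v0 v1 \<open>\<alpha> > 0\<close> by (cases "m = 0 \<or> m = 1") auto
  have v'm: "v' m = 0"
    by (rule DERIV_local_max[OF Dv[OF m01], of "min m (1 - m)"])
      (use m01 in \<open>auto intro!: max simp: abs_if split: if_splits\<close>)
  have v'_less: "v' y < v' x" if "x < y" "x \<in> {0..1}" "y \<in> {0..1}" for x y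
  proof (rule DERIV_neg_imp_decreasing_open[OF \<open>x < y\<close>])
    show "\<exists>z. DERIV v' t :> z \<and> z < 0" if "x < t" "t < y" for t
      using that Dv'[of t] v''_neg[of t] \<open>x \<in> _\<close> \<open>y \<in> _\<close> by auto
    show "continuous_on {x..y} v'"
      by (rule continuous_on_subset[OF contv']) (use \<open>x \<in> _\<close> \<open>y \<in> _\<close> in auto)
  qed
  have v'_pos: "v' x > 0" if "x \<in> {0..<m}" for x
    using v'_less[of x m] that m01 v'm by auto
  have v'_neg: "v' x < 0" if "x \<in> {m<..1}" for x
    using v'_less[of m x] that m01 v'm by auto
  have v_less: "v x < \<alpha>" if "x \<in> {0<..<1}" "x \<noteq> m" for x
  proof (cases "x < m")
    case True
    have "v x < v m"
    proof (rule DERIV_pos_imp_increasing_open[OF True])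
      show "\<exists>z. DERIV v t :> z \<and> z > 0" if "x < t" "t < m" for t
        using that Dv[of t] v'_pos[of t] \<open>x \<in> _\<close> m01 by auto
      show "continuous_on {x..m} v"
        by (rule continuous_on_subset[OF contv]) (use \<open>x \<in> _\<close> m01 in auto)
    qed
    then show ?thesis using vm by simp
  next
    case False
    then have "m < x" using that by simp
    have "v x < v m"
    proof (rule DERIV_neg_imp_decreasing_open[OF \<open>m < x\<close>])
      show "\<exists>z. DERIV v t :> z \<and> z < 0" if "m < t" "t < x" for t
        using that Dv[of t] v'_neg[of t] \<open>x \<in> _\<close> m01 by auto
      show "continuous_on {m..x} v"
        by (rule continuous_on_subset[OF contv]) (use \<open>x \<in> _\<close> m01 in auto)
    qed
    then show ?thesis using vm by simp
  qed
  have energy: "(v' x)\<^sup>2 / 2 + \<mu> * potential p (v x) = \<mu> * potential p \<alpha>" if x: "x \<in> {0<..<1}" for x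
  proof -
    have "(v' x)\<^sup>2 / 2 + \<mu> * potential p (v x) = (v' m)\<^sup>2 / 2 + \<mu> * potential p (v m)"
    proof (rule DERIV_isconst3[of 0 1 x m "\<lambda>x. (v' x)\<^sup>2 / 2 + \<mu> * potential p (v x)"])
      fix y :: real assume y: "y \<in> {0<..<1}"
      have "((\<lambda>x. (v' x)\<^sup>2 / 2 + \<mu> * potential p (v x)) has_real_derivative
          (2 * v' y * v'' y / 2 + \<mu> * ((v y powr p + v y * (sin (v y))\<^sup>2) * v' y))) (at y)"
        by (auto intro!: derivative_eq_intros Dv'[OF y] Dv[OF y]
            DERIV_chain2[where f = "potential p" and g = v, OF DERIV_potential[OF \<open>p > 1\<close> v_pos[OF y]]])
      moreover have "2 * v' y * v'' y / 2 + \<mu> * ((v y powr p + v y * (sin (v y))\<^sup>2) * v' y) = 0"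
        by (simp add: v''_eq[OF y] field_simps)
      ultimately show "((\<lambda>x. (v' x)\<^sup>2 / 2 + \<mu> * potential p (v x)) has_real_derivative 0) (at y)"
        by simp
    qed (use x m01 in auto)
    then show ?thesis by (simp add: v'm vm)
  qed
  \<comment> \<open>the speed constant for which the energy identity becomes \<open>g'\<^sup>2 = \<kappa>\<^sup>2 radicand g\<close> with \<open>g = v / \<alpha>\<close>\<close>
  define \<kappa> where "\<kappa> = sqrt (2 * \<mu> * \<alpha> powr (p - 1) / (p + 1))"
  have "\<kappa> > 0" using \<open>\<mu> > 0\<close> \<open>\<alpha> > 0\<close> \<open>p > 1\<close> by (simp add: \<kappa>_def)
  have scaled: "(v' x / \<alpha>)\<^sup>2 = \<kappa>\<^sup>2 * radicand p \<alpha> (v x / \<alpha>)" if x: "x \<in> {0<..<1}" for x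
  proof -
    have "\<alpha> powr (p + 1) = \<alpha> powr (p - 1) * \<alpha>\<^sup>2"
      using \<open>\<alpha> > 0\<close> powr_add[of \<alpha> "p - 1" 2] by (simp add: add.commute)
    then have "\<kappa>\<^sup>2 * radicand p \<alpha> (v x / \<alpha>)
        = 2 * \<mu> / \<alpha>\<^sup>2 * (potential p \<alpha> - potential p (v x))"
      using \<open>\<mu> > 0\<close> \<open>\<alpha> > 0\<close> \<open>p > 1\<close> unfolding \<kappa>_def radicand_def by simp
    then show ?thesis
      using energy[OF x] \<open>\<alpha> > 0\<close> by (simp add: field_simps)
  qed
  have abs_v': "\<bar>v' x\<bar> / \<alpha> = \<kappa> * sqrt (radicand p \<alpha> (v x / \<alpha>))" if x: "x \<in> {0<..<1}" for x
    using arg_cong[OF scaled[OF x], of sqrt] \<open>\<kappa> > 0\<close> \<open>\<alpha> > 0\<close>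
    by (simp add: real_sqrt_mult real_sqrt_divide)
  let ?A = "LBINT s:{0<..<1}. 1 / sqrt (radicand p \<alpha> s)"
  let ?B = "LBINT s:{0<..<1}. sqrt (radicand p \<alpha> s)"
  note R = isCont_radicand[OF \<open>p > 1\<close> \<open>\<alpha> > 0\<close>] radicand_pos[OF \<open>p > 1\<close> \<open>\<alpha> > 0\<close>]
  have left: "?A = \<kappa> * m" "(LBINT x:{0<..<m}. (v' x / \<alpha>)\<^sup>2) = \<kappa> * ?B"
  proof -
    have c: "continuous_on {0..m} v" "continuous_on {0..m} v'"
      using m01 by (auto intro: continuous_on_subset[OF contv] continuous_on_subset[OF contv'])
    have *: "v x / \<alpha> \<in> {0<..<1}" "v' x / \<alpha> = \<kappa> * sqrt (radicand p \<alpha> (v x / \<alpha>))"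
      "((\<lambda>x. v x / \<alpha>) has_real_derivative v' x / \<alpha>) (at x)"
      if "x \<in> {0<..<m}" for x
    proof -
      show "((\<lambda>x. v x / \<alpha>) has_real_derivative v' x / \<alpha>) (at x)"
        using that m01 by (intro DERIV_cdivide Dv) auto
    qed (use that m01 v_pos[of x] v_less[of x] v'_pos[of x] abs_v'[of x] \<open>\<alpha> > 0\<close> in auto)
    have **: "v' x / \<alpha> \<ge> 0" if "x \<in> {0..m}" for x
      using that v'_pos[of x] v'm \<open>\<alpha> > 0\<close> by (cases "x = m") auto
    have "?A = \<kappa> * (m - 0)"
      by (rule monotone_orbit_integrals(1)[of 0 m \<kappa> "\<lambda>x. v x / \<alpha>" "\<lambda>x. v' x / \<alpha>"])
        (use m01 \<open>\<kappa> > 0\<close> \<open>\<alpha> > 0\<close> v0 vm R c * ** in \<open>auto intro!: continuous_intros\<close>)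
    then show "?A = \<kappa> * m" by simp
    show "(LBINT x:{0<..<m}. (v' x / \<alpha>)\<^sup>2) = \<kappa> * ?B"
      by (rule monotone_orbit_integrals(2)[of 0 m \<kappa> "\<lambda>x. v x / \<alpha>" "\<lambda>x. v' x / \<alpha>"])
        (use m01 \<open>\<kappa> > 0\<close> \<open>\<alpha> > 0\<close> v0 vm R c * ** in \<open>auto intro!: continuous_intros\<close>)
  qed
  have right: "?A = \<kappa> * (1 - m)" "(LBINT x:{m<..<1}. (v' x / \<alpha>)\<^sup>2) = \<kappa> * ?B"
  proof -
    have c: "continuous_on {-1..-m} (\<lambda>x. v (- x))" "continuous_on {-1..-m} (\<lambda>x. v' (- x))"
      using m01 by (auto intro!: continuous_on_compose2[OF contv] continuous_on_compose2[OF contv'] continuous_intros)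
    have *: "v (-x) / \<alpha> \<in> {0<..<1}" "- v' (-x) / \<alpha> = \<kappa> * sqrt (radicand p \<alpha> (v (-x) / \<alpha>))"
      "((\<lambda>x. v (-x) / \<alpha>) has_real_derivative - v' (-x) / \<alpha>) (at x)"
      if x: "x \<in> {-1<..<-m}" for x
    proof -
      have "((\<lambda>x. v (-x)) has_real_derivative - v' (-x)) (at x)"
        using Dv[of "-x"] x m01 by (simp add: DERIV_mirror)
      then show "((\<lambda>x. v (-x) / \<alpha>) has_real_derivative - v' (-x) / \<alpha>) (at x)"
        by (rule DERIV_cdivide)
    qed (use x m01 v_pos[of "-x"] v_less[of "-x"] v'_neg[of "-x"] abs_v'[of "-x"] \<open>\<alpha> > 0\<close> in auto)
    have **: "- v' (-x) / \<alpha> \<ge> 0" if "x \<in> {-1..-m}" for x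
      using that v'_neg[of "-x"] v'm \<open>\<alpha> > 0\<close> by (cases "x = -m") (auto simp: divide_nonpos_pos)
    have "?A = \<kappa> * (- m - - 1)"
      by (rule monotone_orbit_integrals(1)[of "-1" "-m" \<kappa> "\<lambda>x. v (-x) / \<alpha>" "\<lambda>x. - v' (-x) / \<alpha>"])
        (use m01 \<open>\<kappa> > 0\<close> \<open>\<alpha> > 0\<close> v1 vm R c * ** in \<open>auto intro!: continuous_intros\<close>)
    then show "?A = \<kappa> * (1 - m)" by simp
    have "{x. - x \<in> {m<..<1}} = {-1<..<-m}" by auto
    then have "(LBINT x:{m<..<1}. (v' x / \<alpha>)\<^sup>2) = (LBINT x:{-1<..<-m}. (- v' (- x) / \<alpha>)\<^sup>2)"
      using set_integral_reflect[of "{m<..<1}" "\<lambda>x. (v' x / \<alpha>)\<^sup>2"] by (simp add: power2_eq_square)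
    also have "\<dots> = \<kappa> * ?B"
      by (rule monotone_orbit_integrals(2)[of "-1" "-m" \<kappa> "\<lambda>x. v (-x) / \<alpha>" "\<lambda>x. - v' (-x) / \<alpha>"])
        (use m01 \<open>\<kappa> > 0\<close> \<open>\<alpha> > 0\<close> v1 vm R c * ** in \<open>auto intro!: continuous_intros\<close>)
    finally show "(LBINT x:{m<..<1}. (v' x / \<alpha>)\<^sup>2) = \<kappa> * ?B" .
  qed
  \<comment> \<open>the two travelling times add up to the length 1 of the interval\<close>
  have "2 * ?A = \<kappa>"
    using left(1) right(1) distrib_left[of \<kappa> m "1 - m"] by simp
  have int: "set_integrable lborel S (\<lambda>x. (v' x / \<alpha>)\<^sup>2)" if "S \<subseteq> {0..1}" "S \<in> sets borel" for S
  proof -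
    have "set_integrable lborel {0..1} (\<lambda>x. (v' x / \<alpha>)\<^sup>2)"
      using contv' by (intro borel_integrable_atLeastAtMost' continuous_intros) (use \<open>\<alpha> > 0\<close> in auto)
    then show ?thesis by (rule set_integrable_subset) (use that in auto)
  qed
  have "(L2_norm (deriv v))\<^sup>2 = (LBINT x:{0<..<1}. (deriv v x)\<^sup>2)"
    by (simp add: L2_norm_def set_lebesgue_integral_def integral_nonneg_AE)
  also have "\<dots> = (LBINT x:{0<..<1}. \<alpha>\<^sup>2 * (v' x / \<alpha>)\<^sup>2)"
    using \<open>\<alpha> > 0\<close> by (intro set_lebesgue_integral_cong) (auto simp: deriv_v power_divide)
  also have "\<dots> = \<alpha>\<^sup>2 * (LBINT x:{0<..<1}. (v' x / \<alpha>)\<^sup>2)"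
    by simp
  also have "(LBINT x:{0<..<1}. (v' x / \<alpha>)\<^sup>2) = (LBINT x:{0<..<m} \<union> {m<..<1}. (v' x / \<alpha>)\<^sup>2)"
    unfolding set_lebesgue_integral_def
    by (rule integral_discrete_difference[of "{m}"]) (use m01 in \<open>auto simp: indicator_def\<close>)
  also have "\<dots> = (LBINT x:{0<..<m}. (v' x / \<alpha>)\<^sup>2) + (LBINT x:{m<..<1}. (v' x / \<alpha>)\<^sup>2)"
    using m01 by (intro set_integral_Un int) auto
  also have "\<dots> = 2 * \<kappa> * ?B" using left right by simp
  finally show ?thesis using \<open>2 * ?A = \<kappa>\<close> by (simp add: algebra_simps)
qed

section \<open>Moments against powers of the gap\<close>

definition gap :: "real \<Rightarrow> real \<Rightarrow> real" where
  "gap p s = 1 - s powr (p + 1)"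

text \<open>
  The factor \<open>1 - s\<close> is what makes all later estimates uniform up to the singular end point 1.
\<close>

lemma gap_bounds:
  assumes "p > 1" and "s \<in> {0<..<1}"
  shows "1 - s \<le> gap p s" and "gap p s \<le> 1" and "gap p s > 0"
proof -
  have "s powr (p + 1) \<le> s powr 1"
    using assms by (intro powr_mono') auto
  then show "1 - s \<le> gap p s" using assms by (simp add: gap_def)
  then show "gap p s > 0" using assms by simp
  show "gap p s \<le> 1" by (simp add: gap_def)
qed

lemma one_minus_square_bounds:
  fixes s :: real
  assumes "s \<in> {0<..<1}"
  shows "0 \<le> 1 - s\<^sup>2" and "1 - s\<^sup>2 \<le> 2 * (1 - s)"
proof -
  have eq: "1 - s\<^sup>2 = (1 - s) * (1 + s)" by (simp add: algebra_simps power2_eq_square)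
  show "0 \<le> 1 - s\<^sup>2" unfolding eq using assms by auto
  have "(1 - s) * (1 + s) \<le> (1 - s) * 2" using assms by (intro mult_left_mono) auto
  then show "1 - s\<^sup>2 \<le> 2 * (1 - s)" unfolding eq by simp
qed

lemma continuous_on_gap_powr:
  assumes "p > 1"
  shows "continuous_on {0<..<1} (\<lambda>s. gap p s powr e)"
  unfolding gap_def
  by (intro continuous_intros) (use gap_bounds(3)[OF assms] in \<open>force simp: gap_def\<close>)+

text \<open>
  A single dominating function for all integrands.  The exponent exceeds -1, hence integrability;
  it is at most -1/2, the order of the singularity of \<open>(1 - s\<^bsup>p+1\<^esup>)\<^bsup>-1/2\<^esup>\<close>; and -3/4 = 7/4 - 5/2 is what remains of
  the worst second order term once the oscillations are interpolated with exponent 3/4.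
\<close>

definition weight :: "real \<Rightarrow> real" where
  "weight s = (1 - s) powr (- 3 / 4)"

lemma weight_integral:
  shows "set_integrable lborel {0<..<1} weight" and "(LBINT s:{0<..<1}. weight s) = 4"
proof -
  define F :: "real \<Rightarrow> real" where "F s = - 4 * (1 - s) powr (1 / 4)" for s
  have cont: "continuous_on {0..1} F"
    unfolding F_def by (intro continuous_intros continuous_on_powr') auto
  have "(F \<longlongrightarrow> - 4) (at_right 0)" "(F \<longlongrightarrow> 0) (at_left 1)"
    using continuous_on_Icc_at_rightD[OF cont] continuous_on_Icc_at_leftD[OF cont]
    by (auto simp: F_def)
  then have lims: "((F \<circ> real_of_ereal) \<longlongrightarrow> - 4) (at_right (ereal 0))"
    "((F \<circ> real_of_ereal) \<longlongrightarrow> 0) (at_left (ereal 1))"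
    unfolding ereal_tendsto_simps by auto
  have deriv: "DERIV F s :> weight s" if "s < 1" for s
    unfolding F_def weight_def using that by (auto intro!: derivative_eq_intros)
  have isc: "isCont weight s" if "s < 1" for s
    unfolding weight_def using that by (auto intro!: continuous_intros)
  have nonneg: "weight s \<ge> 0" for s
    by (simp add: weight_def)
  have "set_integrable lborel (einterval (ereal 0) (ereal 1)) weight"
    by (rule interval_integral_FTC_nonneg(1)[of _ _ F]) (use deriv isc lims nonneg in auto)
  then show "set_integrable lborel {0<..<1} weight" by simp
  have "(LBINT s=ereal 0..ereal 1. weight s) = 0 - - 4"
    by (rule interval_integral_FTC_nonneg(2)[of _ _ F]) (use deriv isc lims nonneg in auto)
  then show "(LBINT s:{0<..<1}. weight s) = 4"
    by (simp add: interval_integral_Ioo)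
qed

lemma integral_bound_weight:
  fixes f :: "real \<Rightarrow> real"
  assumes cont: "continuous_on {0<..<1} f"
    and bound: "\<And>s. s \<in> {0<..<1} \<Longrightarrow> \<bar>f s\<bar> \<le> C * weight s"
  shows "set_integrable lborel {0<..<1} f" and "\<bar>LBINT s:{0<..<1}. f s\<bar> \<le> 4 * C"
proof -
  have w: "set_integrable lborel {0<..<1} (\<lambda>s. C * weight s)"
    using weight_integral(1) by simp
  have "set_borel_measurable lborel {0<..<1} f"
    using set_measurable_continuous_on[OF _ cont] by (simp add: set_borel_measurable_def)
  moreover have "norm (f s) \<le> norm (C * weight s)" if "s \<in> {0<..<1}" for s
    using bound[OF that] by simp
  ultimately show f: "set_integrable lborel {0<..<1} f"
    by (intro set_integrable_bound[OF w]) auto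
  have "\<bar>LBINT s:{0<..<1}. f s\<bar> \<le> (LBINT s:{0<..<1}. \<bar>f s\<bar>)"
    using set_integral_norm_bound[OF f] by simp
  also have "\<dots> \<le> (LBINT s:{0<..<1}. C * weight s)"
    by (intro set_integral_mono set_integrable_abs f w bound)
  also have "\<dots> = 4 * C" using weight_integral(2) by simp
  finally show "\<bar>LBINT s:{0<..<1}. f s\<bar> \<le> 4 * C" .
qed

lemma gap_powr_le_weight:
  assumes "p > 1" and "s \<in> {0<..<1}" and "k \<ge> - 3 / 4" and "k - e \<ge> - 3 / 4"
  shows "(1 - s) powr k * gap p s powr (- e) \<le> weight s"
proof (cases "e \<ge> 0")
  case True
  have "(1 - s) powr k * gap p s powr (- e) \<le> (1 - s) powr k * (1 - s) powr (- e)"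
    using gap_bounds[OF assms(1,2)] assms True by (intro mult_left_mono powr_mono2') auto
  also have "\<dots> = (1 - s) powr (k - e)"
    by (simp flip: powr_add)
  also have "\<dots> \<le> weight s"
    unfolding weight_def using assms by (intro powr_mono') auto
  finally show ?thesis .
next
  case False
  have "(1 - s) powr k * gap p s powr (- e) \<le> (1 - s) powr k * 1"
    using gap_bounds[OF assms(1,2)] False by (intro mult_left_mono powr_le1) auto
  also have "\<dots> \<le> weight s"
    unfolding weight_def using assms by (auto intro!: powr_mono')
  finally show ?thesis .
qed

text \<open>
  For \<open>e = - 1 / 2\<close> this integrates against the square root of the gap, for positive \<open>e\<close> against
  a function that is singular at 1.
\<close>

definition moment :: "real \<Rightarrow> real \<Rightarrow> (real \<Rightarrow> real) \<Rightarrow> real" where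
  "moment p e \<phi> = (LBINT s:{0<..<1}. \<phi> s * gap p s powr (- e))"

text \<open>
  The gap vanishes to first order at 1, so a zero of order \<open>k\<close> of the integrand there outweighs the
  singularity as soon as \<open>k - e\<close> is not below the exponent of the weight.
\<close>

lemma gap_moment:
  assumes "p > 1" and cont: "continuous_on {0<..<1} \<phi>"
    and bound: "\<And>s. s \<in> {0<..<1} \<Longrightarrow> \<bar>\<phi> s\<bar> \<le> C * (1 - s) powr k"
    and "k \<ge> - 3 / 4" and "k - e \<ge> - 3 / 4"
  shows "set_integrable lborel {0<..<1} (\<lambda>s. \<phi> s * gap p s powr (- e))"
    and "\<bar>moment p e \<phi>\<bar> \<le> 4 * C"
proof -
  have "0 \<le> C * (1 - 1 / 2) powr k"
    using bound[of "1 / 2"] by (intro order_trans[OF abs_ge_zero]) auto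
  then have "C \<ge> 0" by (simp add: zero_le_mult_iff)
  have *: "\<bar>\<phi> s * gap p s powr (- e)\<bar> \<le> C * weight s" if s: "s \<in> {0<..<1}" for s
  proof -
    have "\<bar>\<phi> s * gap p s powr (- e)\<bar> \<le> C * ((1 - s) powr k * gap p s powr (- e))"
      using bound[OF s] by (auto simp: abs_mult mult.assoc[symmetric] intro!: mult_right_mono)
    also have "\<dots> \<le> C * weight s"
      using gap_powr_le_weight[OF \<open>p > 1\<close> s assms(4,5)] \<open>C \<ge> 0\<close> by (rule mult_left_mono)
    finally show ?thesis .
  qed
  have "continuous_on {0<..<1} (\<lambda>s. \<phi> s * gap p s powr (- e))"
    by (intro continuous_on_mult cont continuous_on_gap_powr \<open>p > 1\<close>)
  then show "set_integrable lborel {0<..<1} (\<lambda>s. \<phi> s * gap p s powr (- e))"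
    and "\<bar>moment p e \<phi>\<bar> \<le> 4 * C"
    unfolding moment_def using integral_bound_weight * by blast+
qed

lemma moment_linear:
  assumes "set_integrable lborel {0<..<1} (\<lambda>s. \<phi> s * gap p s powr (- e))"
    and "set_integrable lborel {0<..<1} (\<lambda>s. h s * gap p s powr (- e))"
  shows "moment p e (\<lambda>s. a * \<phi> s + b * h s) = a * moment p e \<phi> + b * moment p e h"
    and "set_integrable lborel {0<..<1} (\<lambda>s. (a * \<phi> s + b * h s) * gap p s powr (- e))"
proof -
  have eq: "(a * \<phi> s + b * h s) * gap p s powr (- e)
      = a * (\<phi> s * gap p s powr (- e)) + b * (h s * gap p s powr (- e))" for s
    by (simp add: algebra_simps)
  note int = set_integrable_mult_right[OF assms(1), of a] set_integrable_mult_right[OF assms(2), of b]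
  show "set_integrable lborel {0<..<1} (\<lambda>s. (a * \<phi> s + b * h s) * gap p s powr (- e))"
    unfolding eq by (rule set_integral_add(1)[OF int])
  show "moment p e (\<lambda>s. a * \<phi> s + b * h s) = a * moment p e \<phi> + b * moment p e h"
    unfolding moment_def eq using set_integral_add(2)[OF int] by simp
qed

text \<open>
  The function \<open>s (1 - s\<^bsup>p+1\<^esup>)\<^bsup>-1/2\<^esup>\<close> has derivative
  \<open>(p + 1) / 2 (1 - s\<^bsup>p+1\<^esup>)\<^bsup>-3/2\<^esup> - (p - 1) / 2 (1 - s\<^bsup>p+1\<^esup>)\<^bsup>-1/2\<^esup>\<close>; integrating it against \<open>\<psi>\<close>
  trades the exponent 3/2 for 1/2 at the price of a derivative of \<open>\<psi>\<close>.  The boundary term at 1 vanishes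
  because \<open>\<psi>\<close> is Lipschitz and zero there.
\<close>

lemma gap_integration_by_parts:
  assumes "p > 1" and deriv: "\<And>s. DERIV \<psi> s :> \<psi>' s" and cont: "continuous_on UNIV \<psi>'"
    and "\<psi> 1 = 0" and bound: "\<And>s. \<bar>\<psi>' s\<bar> \<le> C"
  shows "(p + 1) * moment p (3 / 2) \<psi>
       = (p - 1) * moment p (1 / 2) \<psi> - 2 * moment p (1 / 2) (\<lambda>s. \<psi>' s * s)"
proof -
  have cont\<psi>: "continuous_on S \<psi>" for S
    by (intro continuous_at_imp_continuous_on ballI DERIV_isCont[OF deriv])
  have cont': "continuous_on S \<psi>'" for S
    using continuous_on_subset[OF cont] by simp
  have lip: "\<bar>\<psi> s\<bar> \<le> C * (1 - s)" if "s \<in> {0<..<1}" for s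
  proof -
    have "\<bar>\<psi> s - \<psi> 1\<bar> \<le> C * \<bar>s - 1\<bar>"
      using field_differentiable_bound[of UNIV \<psi> \<psi>' C s 1] deriv bound by auto
    then show ?thesis using that \<open>\<psi> 1 = 0\<close> by simp
  qed
  \<comment> \<open>the antiderivative behind the identity, with derivative \<open>f\<close>\<close>
  define F where "F s = \<psi> s * s * gap p s powr (- (1 / 2))" for s
  define f where "f s = (p + 1) / 2 * (\<psi> s * gap p s powr (- (3 / 2)))
      - (p - 1) / 2 * (\<psi> s * gap p s powr (- (1 / 2)))
      + \<psi>' s * s * gap p s powr (- (1 / 2))" for s
  have C0: "C \<ge> 0" using bound[of 0] by linarith
  have abs_s: "\<bar>\<psi>' s * s\<bar> \<le> C" "\<bar>\<psi> s\<bar> \<le> C" if "s \<in> {0<..<1}" for s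
  proof -
    have "\<bar>\<psi>' s * s\<bar> \<le> C * 1"
      unfolding abs_mult using that bound[of s] C0 by (intro mult_mono) auto
    then show "\<bar>\<psi>' s * s\<bar> \<le> C" by simp
    have "C * (1 - s) \<le> C * 1" using that C0 by (intro mult_left_mono) auto
    then show "\<bar>\<psi> s\<bar> \<le> C" using lip[OF that] by simp
  qed
  have I1: "set_integrable lborel {0<..<1} (\<lambda>s. \<psi> s * gap p s powr (- (3 / 2)))"
    by (rule gap_moment(1)[where C = C and k = 1]) (use \<open>p > 1\<close> cont\<psi> lip in auto)
  have I2: "set_integrable lborel {0<..<1} (\<lambda>s. \<psi> s * gap p s powr (- (1 / 2)))"
    by (rule gap_moment(1)[where C = C and k = 0]) (use \<open>p > 1\<close> cont\<psi> abs_s in auto)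
  have I3: "set_integrable lborel {0<..<1} (\<lambda>s. \<psi>' s * s * gap p s powr (- (1 / 2)))"
    by (rule gap_moment(1)[where C = C and k = 0])
      (use \<open>p > 1\<close> cont' abs_s in \<open>auto intro!: continuous_intros\<close>)
  have DF: "DERIV F s :> f s" if s: "s \<in> {0<..<1}" for s
  proof -
    have g: "gap p s > 0" using gap_bounds(3)[OF \<open>p > 1\<close> s] .
    have "DERIV (gap p) s :> - ((p + 1) * s powr p)"
      unfolding gap_def using s by (auto intro!: derivative_eq_intros)
    then have "DERIV (\<lambda>s. gap p s powr (- (1 / 2))) s :>
        - (1 / 2) * gap p s powr (- (1 / 2) - 1) * (- ((p + 1) * s powr p))"
      using g by (auto intro!: derivative_eq_intros)
    from DERIV_mult[OF DERIV_mult[OF deriv DERIV_ident] this]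
    have "DERIV F s :> (\<psi>' s * s + \<psi> s) * gap p s powr (- (1 / 2))
        + \<psi> s * s * (- (1 / 2) * gap p s powr (- (1 / 2) - 1) * (- ((p + 1) * s powr p)))"
      unfolding F_def by (simp add: algebra_simps)
    also have "(\<psi>' s * s + \<psi> s) * gap p s powr (- (1 / 2))
        + \<psi> s * s * (- (1 / 2) * gap p s powr (- (1 / 2) - 1) * (- ((p + 1) * s powr p)))
      = (\<psi>' s * s + \<psi> s) * gap p s powr (- (1 / 2))
        + (p + 1) / 2 * \<psi> s * gap p s powr (- (3 / 2)) * (s * s powr p)"
      by (simp add: algebra_simps add_divide_distrib diff_divide_distrib)
    also have "s * s powr p = 1 - gap p s"
      using s by (simp add: gap_def powr_add)
    also have "(\<psi>' s * s + \<psi> s) * gap p s powr (- (1 / 2))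
        + (p + 1) / 2 * \<psi> s * gap p s powr (- (3 / 2)) * (1 - gap p s)
      = (\<psi>' s * s + \<psi> s) * gap p s powr (- (1 / 2))
        + (p + 1) / 2 * \<psi> s * (gap p s powr (- (3 / 2)) - gap p s * gap p s powr (- (3 / 2)))"
      by (simp add: algebra_simps add_divide_distrib diff_divide_distrib)
    also have "gap p s * gap p s powr (- (3 / 2)) = gap p s powr (- (1 / 2))"
      using g powr_add[of "gap p s" 1 "- (3 / 2)"] by simp
    finally show ?thesis
      unfolding f_def by (simp add: algebra_simps add_divide_distrib diff_divide_distrib)
  qed
  have cont_f: "isCont f s" if "s \<in> {0<..<1}" for s
  proof -
    have "continuous_on {0<..<1} f"
      unfolding f_def by (intro continuous_intros cont\<psi> cont' continuous_on_gap_powr \<open>p > 1\<close>)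
    then show ?thesis using that by (simp add: continuous_on_eq_continuous_at)
  qed
  have F_bound: "\<bar>F s\<bar> \<le> C * (s * sqrt (1 - s))" if s: "s \<in> {0<..<1}" for s
  proof -
    have "\<bar>F s\<bar> \<le> C * (1 - s) * s * gap p s powr (- (1 / 2))"
      using lip[OF s] s unfolding F_def abs_mult by (intro mult_mono) auto
    also have "\<dots> \<le> C * (1 - s) * s * (1 - s) powr (- (1 / 2))"
      using gap_bounds[OF \<open>p > 1\<close> s] s C0 by (intro mult_left_mono powr_mono2') auto
    also have "\<dots> = C * (s * sqrt (1 - s))"
      using s powr_add[of "1 - s" 1 "- (1 / 2)"] by (simp add: powr_half_sqrt)
    finally show ?thesis .
  qed
  have lim: "((\<lambda>s. C * (s * sqrt (1 - s))) \<longlongrightarrow> 0) (at_right 0)"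
      "((\<lambda>s. C * (s * sqrt (1 - s))) \<longlongrightarrow> 0) (at_left 1)"
    by (auto intro!: tendsto_eq_intros)
  have "(F \<longlongrightarrow> 0) (at_right 0)"
    by (rule Lim_null_comparison[OF _ lim(1)])
      (use F_bound in \<open>auto intro!: eventually_at_rightI[of 0 1]\<close>)
  moreover have "(F \<longlongrightarrow> 0) (at_left 1)"
    by (rule Lim_null_comparison[OF _ lim(2)])
      (use F_bound in \<open>auto intro!: eventually_at_leftI[of 0 1]\<close>)
  ultimately have lims: "((F \<circ> real_of_ereal) \<longlongrightarrow> 0) (at_right (ereal 0))"
    "((F \<circ> real_of_ereal) \<longlongrightarrow> 0) (at_left (ereal 1))"
    unfolding ereal_tendsto_simps by auto
  have "set_integrable lborel {0<..<1} f"
    unfolding f_def by (intro set_integral_add set_integral_diff set_integrable_mult_right I1 I2 I3)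
  then have "(LBINT s=ereal 0..ereal 1. f s) = 0 - 0"
    using DF cont_f
    by (intro interval_integral_FTC_integrable[of _ _ F] lims)
      (simp_all flip: has_real_derivative_iff_has_vector_derivative)
  then have "(LBINT s:{0<..<1}. f s) = 0"
    by (simp add: interval_integral_Ioo)
  moreover have "(LBINT s:{0<..<1}. f s) = (p + 1) / 2 * moment p (3 / 2) \<psi>
      - (p - 1) / 2 * moment p (1 / 2) \<psi> + moment p (1 / 2) (\<lambda>s. \<psi>' s * s)"
    unfolding f_def moment_def
    by (subst set_integral_add(2) set_integral_diff(2),
        intro set_integral_diff(1) set_integrable_mult_right I1 I2 I3, rule I3,
        subst set_integral_diff(2), intro set_integrable_mult_right I1 I2,
        intro set_integrable_mult_right I1 I2, simp only: set_integral_mult_right)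
  ultimately show ?thesis by (simp add: algebra_simps add_divide_distrib diff_divide_distrib)
qed

section \<open>The coefficients as moments\<close>

lemma continuous_on_unit_interval_bounded:
  fixes \<phi> :: "real \<Rightarrow> real"
  assumes "continuous_on {0..1} \<phi>"
  obtains C where "\<And>s. s \<in> {0..1} \<Longrightarrow> \<bar>\<phi> s\<bar> \<le> C"
proof -
  obtain C where "\<forall>x\<in>\<phi> ` {0..1}. norm x \<le> C"
    using compact_imp_bounded[OF compact_continuous_image[OF assms]] unfolding bounded_iff by auto
  then show ?thesis using that[of C] by auto
qed

text \<open>
  The substitution is \<open>sin \<theta> = s powr ((p + 1) / 2)\<close>, under which \<open>1 - s\<^bsup>p+1\<^esup>\<close> becomes \<open>cos\<^sup>2 \<theta>\<close>.  It is carried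
  out for non-negative integrands, where integrability in \<open>\<theta>\<close> comes for free from integrability in \<open>s\<close>;
  a bounded \<open>\<phi>\<close> is then the difference of \<open>\<phi> + C\<close> and the constant \<open>C\<close>.
\<close>

lemma sine_power_substitution:
  assumes "p > 1" and cont: "continuous_on {0..1} \<phi>"
  shows "(LBINT \<theta>:{0<..<pi/2}. \<phi> (sin \<theta> powr (2 / (p + 1))) * sin \<theta> powr ((1 - p) / (p + 1)))
       = (p + 1) / 2 * moment p (1 / 2) \<phi>"
proof -
  \<comment> \<open>the inverse substitution \<open>\<theta> = g s\<close>, so that integrability is known on the side of \<open>s\<close>\<close>
  define g where "g s = arcsin (s powr ((p + 1) / 2))" for s
  define g' where "g' s = inverse (sqrt (1 - (s powr ((p + 1) / 2))\<^sup>2)) * ((p + 1) / 2 * s powr ((p - 1) / 2))"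
    for s
  have sq: "(s powr ((p + 1) / 2))\<^sup>2 = s powr (p + 1)" for s
    by (simp add: power2_eq_square flip: powr_add)
  have pow01: "s powr ((p + 1) / 2) \<in> {0<..<1}" if "s \<in> {0<..<1}" for s
    using that \<open>p > 1\<close> powr_less_mono2[of "(p + 1) / 2" s 1] by auto
  have minus1_le: "- 1 \<le> s powr ((p + 1) / 2)" for s :: real
    by (rule order_trans[OF _ powr_ge_zero]) simp
  have deriv: "DERIV g s :> g' s" if s: "s \<in> {0<..<1}" for s
  proof -
    have "DERIV (\<lambda>s. s powr ((p + 1) / 2)) s :> (p + 1) / 2 * s powr ((p - 1) / 2)"
      using s \<open>p > 1\<close> by (auto intro!: derivative_eq_intros simp: field_simps)
    then show ?thesis
      unfolding g_def g'_def using pow01[OF s]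
      by (intro DERIV_chain2[OF DERIV_arcsin]) (auto intro: less_trans[of "- 1" 0])
  qed
  have cont_g': "isCont g' s" if s: "s \<in> {0<..<1}" for s
    unfolding g'_def using s pow01[OF s] gap_bounds(3)[OF \<open>p > 1\<close> s]
    by (auto intro!: continuous_intros simp: sq gap_def)
  have g'_nonneg: "g' s \<ge> 0" if "s \<in> {0..1}" for s
    unfolding g'_def sq using that \<open>p > 1\<close> by (auto simp: powr_le1)
  have "continuous_on {0..1} g"
    unfolding g_def using \<open>p > 1\<close>
    by (intro continuous_on_arcsin' continuous_on_powr' continuous_intros) (auto simp: powr_le1 intro: order_trans[of _ 0])
  then have "(g \<longlongrightarrow> 0) (at_right 0)" "(g \<longlongrightarrow> pi / 2) (at_left 1)"
    using continuous_on_Icc_at_rightD[of 0 1 g] continuous_on_Icc_at_leftD[of 0 1 g]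
    by (auto simp: g_def)
  then have lims: "((ereal \<circ> g \<circ> real_of_ereal) \<longlongrightarrow> ereal 0) (at_right (ereal 0))"
    "((ereal \<circ> g \<circ> real_of_ereal) \<longlongrightarrow> ereal (pi / 2)) (at_left (ereal 1))"
    unfolding ereal_tendsto_simps by (auto simp: o_def)
  define f where "f h \<theta> = h (sin \<theta> powr (2 / (p + 1))) * sin \<theta> powr ((1 - p) / (p + 1))"
    for h :: "real \<Rightarrow> real" and \<theta>
  have nonneg_case: "set_integrable lborel {0<..<pi/2} (f h)"
    "(LBINT \<theta>:{0<..<pi/2}. f h \<theta>) = (p + 1) / 2 * moment p (1 / 2) h"
    if h: "continuous_on {0..1} h" "\<And>s. s \<in> {0..1} \<Longrightarrow> h s \<ge> 0" for h
  proof -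
    have fg: "f h (g s) * g' s = (p + 1) / 2 * (h s * gap p s powr (- (1 / 2)))"
      if s: "s \<in> {0<..<1}" for s
    proof -
      have sin_g: "sin (g s) = s powr ((p + 1) / 2)"
        unfolding g_def using pow01[OF s] by (intro sin_arcsin) (auto intro: order_trans[of "- 1" 0])
      have exponents: "(p + 1) / 2 * (2 / (p + 1)) = 1" "(p + 1) / 2 * ((1 - p) / (p + 1)) = (1 - p) / 2"
        using \<open>p > 1\<close> by (auto simp: divide_simps)
      have "sin (g s) powr (2 / (p + 1)) = s"
        and "sin (g s) powr ((1 - p) / (p + 1)) = s powr ((1 - p) / 2)"
        using s unfolding sin_g powr_powr exponents by simp_all
      then have "f h (g s) * g' s
          = (p + 1) / 2 * (h s * inverse (sqrt (gap p s))) * (s powr ((1 - p) / 2) * s powr ((p - 1) / 2))"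
        unfolding f_def g'_def sq gap_def by simp
      also have "s powr ((1 - p) / 2) * s powr ((p - 1) / 2) = 1"
        using s by (simp add: diff_divide_distrib flip: powr_add)
      also have "inverse (sqrt (gap p s)) = gap p s powr (- (1 / 2))"
        using gap_bounds(3)[OF \<open>p > 1\<close> s] by (simp add: powr_minus powr_half_sqrt)
      finally show ?thesis by simp
    qed
    obtain C where C: "\<And>s. s \<in> {0..1} \<Longrightarrow> \<bar>h s\<bar> \<le> C"
      using continuous_on_unit_interval_bounded[OF h(1)] by blast
    have mom: "set_integrable lborel {0<..<1} (\<lambda>s. h s * gap p s powr (- (1 / 2)))"
      by (rule gap_moment(1)[where C = C and k = 0])
        (use \<open>p > 1\<close> C in \<open>auto intro!: continuous_on_subset[OF h(1)]\<close>)
    have cont_f: "isCont (f h) \<theta>" if \<theta>: "\<theta> \<in> {0<..<pi/2}" for \<theta>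
    proof -
      have s: "sin \<theta> \<in> {0<..<1}"
        using \<theta> sin_gt_zero2[of \<theta>] sin_monotone_2pi[of \<theta> "pi / 2"] by auto
      then have "sin \<theta> powr (2 / (p + 1)) \<in> {0<..<1}"
        using \<open>p > 1\<close> powr_less_mono2[of "2 / (p + 1)" "sin \<theta>" 1] by auto
      then have "isCont h (sin \<theta> powr (2 / (p + 1)))"
        using continuous_on_interior[OF h(1)] by auto
      then show ?thesis
        unfolding f_def using s
        by (intro continuous_intros isCont_o2[where g = h and f = "\<lambda>\<theta>. sin \<theta> powr (2 / (p + 1))"]) auto
    qed
    have g01: "g s \<in> {0<..<pi/2}" if "s \<in> {0<..<1}" for s
      using minus1_le[of s] unfolding g_def using pow01[OF that] arcsin_less_arcsin[of 0 "s powr ((p + 1) / 2)"]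
        arcsin_less_arcsin[of "s powr ((p + 1) / 2)" 1] by auto
    have "set_integrable lborel (einterval (ereal 0) (ereal 1)) (\<lambda>s. f h (g s) * g' s)
      \<longleftrightarrow> set_integrable lborel {0<..<1} (\<lambda>s. (p + 1) / 2 * (h s * gap p s powr (- (1 / 2))))"
      by (intro set_integrable_cong) (auto simp: fg)
    then have int: "set_integrable lborel (einterval (ereal 0) (ereal 1)) (\<lambda>s. f h (g s) * g' s)"
      using mom by simp
    have f_nonneg: "0 \<le> f h (g s)" if "s \<in> {0<..<1}" for s
    proof -
      have "sin (g s) powr (2 / (p + 1)) \<in> {0..1}"
        using \<open>p > 1\<close> g01[OF that] sin_ge_zero[of "g s"] by (auto intro!: powr_le1)
      then show ?thesis unfolding f_def by (simp add: h(2))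
    qed
    note facts = deriv cont_f g01 cont_g' f_nonneg g'_nonneg lims int
    have "set_integrable lborel (einterval (ereal 0) (ereal (pi/2))) (f h)"
      by (rule interval_integral_substitution_nonneg(1)[of "ereal 0" "ereal 1" g g']) (use facts in auto)
    then show "set_integrable lborel {0<..<pi/2} (f h)" by simp
    have "(LBINT \<theta>=ereal 0..ereal (pi/2). f h \<theta>) = (LBINT s=ereal 0..ereal 1. f h (g s) * g' s)"
      by (rule interval_integral_substitution_nonneg(2)[of "ereal 0" "ereal 1" g g']) (use facts in auto)
    then have "(LBINT \<theta>:{0<..<pi/2}. f h \<theta>) = (LBINT s:{0<..<1}. f h (g s) * g' s)"
      by (simp add: interval_integral_Ioo)
    also have "\<dots> = (LBINT s:{0<..<1}. (p + 1) / 2 * (h s * gap p s powr (- (1 / 2))))"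
      by (intro set_lebesgue_integral_cong) (auto simp: fg)
    finally show "(LBINT \<theta>:{0<..<pi/2}. f h \<theta>) = (p + 1) / 2 * moment p (1 / 2) h"
      unfolding moment_def by simp
  qed
  obtain C where C: "\<And>s. s \<in> {0..1} \<Longrightarrow> \<bar>\<phi> s\<bar> \<le> C"
    using continuous_on_unit_interval_bounded[OF cont] by blast
  have "C \<ge> 0" using C[of 0] by auto
  have "continuous_on {0..1} (\<lambda>s. \<phi> s + C)" "continuous_on {0..1} (\<lambda>_::real. C)"
    by (intro continuous_intros cont)+
  moreover have "\<phi> s + C \<ge> 0" if "s \<in> {0..1}" for s
    using C[OF that] by (auto simp: abs_le_iff)
  ultimately have P: "set_integrable lborel {0<..<pi/2} (f (\<lambda>s. \<phi> s + C))"
      "(LBINT \<theta>:{0<..<pi/2}. f (\<lambda>s. \<phi> s + C) \<theta>) = (p + 1) / 2 * moment p (1 / 2) (\<lambda>s. \<phi> s + C)"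
    and N: "set_integrable lborel {0<..<pi/2} (f (\<lambda>_. C))"
      "(LBINT \<theta>:{0<..<pi/2}. f (\<lambda>_. C) \<theta>) = (p + 1) / 2 * moment p (1 / 2) (\<lambda>_. C)"
    using nonneg_case[of "\<lambda>s. \<phi> s + C"] nonneg_case[of "\<lambda>_. C"] \<open>C \<ge> 0\<close> by auto
  have "(LBINT \<theta>:{0<..<pi/2}. f \<phi> \<theta>) = (LBINT \<theta>:{0<..<pi/2}. f (\<lambda>s. \<phi> s + C) \<theta> - f (\<lambda>_. C) \<theta>)"
    by (simp add: f_def algebra_simps)
  also have "\<dots> = (p + 1) / 2 * (moment p (1 / 2) (\<lambda>s. \<phi> s + C) - moment p (1 / 2) (\<lambda>_. C))"
    using set_integral_diff(2)[OF P(1) N(1)] P(2) N(2) by (simp add: right_diff_distrib)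
  also have "moment p (1 / 2) (\<lambda>s. \<phi> s + C) - moment p (1 / 2) (\<lambda>_. C)
      = (LBINT s:{0<..<1}. (\<phi> s + C) * gap p s powr (- (1 / 2)) - C * gap p s powr (- (1 / 2)))"
    unfolding moment_def
  proof (rule set_integral_diff(2)[symmetric])
    have "\<bar>\<phi> s + C\<bar> \<le> 2 * C" if "s \<in> {0..1}" for s
      using C[OF that] by (auto simp: abs_le_iff)
    then show "set_integrable lborel {0<..<1} (\<lambda>s. (\<phi> s + C) * gap p s powr (- (1 / 2)))"
      by (intro gap_moment(1)[where C = "2 * C" and k = 0])
        (use \<open>p > 1\<close> in \<open>auto intro!: continuous_intros continuous_on_subset[OF cont]\<close>)
    show "set_integrable lborel {0<..<1} (\<lambda>s. C * gap p s powr (- (1 / 2)))"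
      by (intro gap_moment(1)[where C = C and k = 0]) (use \<open>p > 1\<close> \<open>C \<ge> 0\<close> in auto)
  qed
  also have "\<dots> = moment p (1 / 2) \<phi>"
    unfolding moment_def by (simp add: algebra_simps)
  finally show ?thesis unfolding f_def .
qed

lemma gap_quotient:
  assumes "p > 1" and "s \<in> {0<..<1}"
  shows "x / (1 - s powr (p + 1)) powr e = x * gap p s powr (- e)"
    and "x / sqrt (1 - s powr (p + 1)) = x * gap p s powr (- (1 / 2))"
    and "sqrt (1 - s powr (p + 1)) = gap p s powr (- (- 1 / 2))"
  using gap_bounds(3)[OF assms] by (simp_all add: gap_def powr_minus_divide powr_half_sqrt)

text \<open>
  With all coefficients written as moments of the same kind, comparing them with the terms of the
  Taylor expansion is pure algebra.
\<close>

lemma coefficients_as_moments: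
  assumes "p > 1"
  shows "C0 p = moment p (1 / 2) (\<lambda>_. 1)"
    and "C1 p = - ((p + 1) / 8) * moment p (3 / 2) (\<lambda>s. 1 - s\<^sup>2)"
    and "C2 p = 3 * (p + 1)\<^sup>2 / 128 * moment p (5 / 2) (\<lambda>s. (1 - s\<^sup>2)\<^sup>2)"
    and "E0 p = moment p (- 1 / 2) (\<lambda>_. 1)"
    and "E1 p = (p + 1) / 8 * moment p (1 / 2) (\<lambda>s. 1 - s\<^sup>2)"
    and "E4 p = - ((p + 1)\<^sup>2 / 128) * moment p (3 / 2) (\<lambda>s. (1 - s\<^sup>2)\<^sup>2)"
proof -
  have "(LBINT s:{0<..<1}. \<phi> s / (1 - s powr (p + 1)) powr e) = moment p e \<phi>"
    and half: "(LBINT s:{0<..<1}. \<phi> s / sqrt (1 - s powr (p + 1))) = moment p (1 / 2) \<phi>" for e \<phi>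
    unfolding moment_def
    by (intro set_lebesgue_integral_cong; simp add: gap_quotient(1,2)[OF assms])+
  then show "C0 p = moment p (1 / 2) (\<lambda>_. 1)"
    and "C1 p = - ((p + 1) / 8) * moment p (3 / 2) (\<lambda>s. 1 - s\<^sup>2)"
    and "C2 p = 3 * (p + 1)\<^sup>2 / 128 * moment p (5 / 2) (\<lambda>s. (1 - s\<^sup>2)\<^sup>2)"
    and "E1 p = (p + 1) / 8 * moment p (1 / 2) (\<lambda>s. 1 - s\<^sup>2)"
    and "E4 p = - ((p + 1)\<^sup>2 / 128) * moment p (3 / 2) (\<lambda>s. (1 - s\<^sup>2)\<^sup>2)"
    unfolding C0_def C1_def C2_def E1_def E4_def by simp_all
  show "E0 p = moment p (- 1 / 2) (\<lambda>_. 1)"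
    unfolding E0_def moment_def
    by (intro set_lebesgue_integral_cong) (auto simp: gap_quotient(3)[OF assms])
qed

lemma oscillating_coefficients_as_moments:
  assumes "p > 1"
  shows "C11 p \<alpha> = moment p (1 / 2) (\<lambda>s. cos (2 * \<alpha> * s) * s)"
    and "C12 p \<alpha> = (p - 1) / 4 * moment p (1 / 2) (\<lambda>s. sin (2 * \<alpha>) - sin (2 * \<alpha> * s))
      + (p + 1) / 4 * moment p (3 / 2) (\<lambda>s. (1 - s) * sin (2 * \<alpha> * s))"
    and "C21 p \<alpha> = - (1 / 2) * moment p (1 / 2) (\<lambda>s. sin (2 * \<alpha> * s) * s)"
    and "E2 p \<alpha> = - ((p + 1) / 8) * moment p (1 / 2) (\<lambda>s. sin (2 * \<alpha>) - s * sin (2 * \<alpha> * s))"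
proof -
  have shift: "sin \<theta> powr ((3 - p) / (p + 1)) = sin \<theta> powr (2 / (p + 1)) * sin \<theta> powr ((1 - p) / (p + 1))" for \<theta>
    using assms by (simp flip: powr_add add_divide_distrib)
  have "C11 p \<alpha> = 2 / (p + 1) * ((p + 1) / 2 * moment p (1 / 2) (\<lambda>s. cos (2 * \<alpha> * s) * s))"
    unfolding C11_def shift
    by (subst sine_power_substitution[symmetric, OF assms]) (auto intro!: continuous_intros simp: mult.assoc)
  then show "C11 p \<alpha> = moment p (1 / 2) (\<lambda>s. cos (2 * \<alpha> * s) * s)" using assms by simp
  have "C21 p \<alpha> = - (1 / (p + 1)) * ((p + 1) / 2 * moment p (1 / 2) (\<lambda>s. sin (2 * \<alpha> * s) * s))"
    unfolding C21_def shift
    by (subst sine_power_substitution[symmetric, OF assms]) (auto intro!: continuous_intros simp: mult.assoc)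
  then show "C21 p \<alpha> = - (1 / 2) * moment p (1 / 2) (\<lambda>s. sin (2 * \<alpha> * s) * s)" using assms by simp
  have "E2 p \<alpha> = - (1 / 4) * ((p + 1) / 2 * moment p (1 / 2) (\<lambda>s. sin (2 * \<alpha>) - s * sin (2 * \<alpha> * s)))"
    unfolding E2_def
    by (subst sine_power_substitution[symmetric, OF assms]) (auto intro!: continuous_intros)
  then show "E2 p \<alpha> = - ((p + 1) / 8) * moment p (1 / 2) (\<lambda>s. sin (2 * \<alpha>) - s * sin (2 * \<alpha> * s))" by simp
  have "(LBINT \<theta>:{0<..<pi/2}. (sin (2 * \<alpha>) - sin (2 * \<alpha> * sin \<theta> powr (2 / (p + 1)))) * sin \<theta> powr ((1 - p) / (p + 1)))
      = (p + 1) / 2 * moment p (1 / 2) (\<lambda>s. sin (2 * \<alpha>) - sin (2 * \<alpha> * s))"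
    by (subst sine_power_substitution[symmetric, OF assms]) (auto intro!: continuous_intros)
  moreover have "(LBINT s:{0<..<1}. (1 - s) / (1 - s powr (p + 1)) powr (3/2) * sin (2 * \<alpha> * s))
      = moment p (3 / 2) (\<lambda>s. (1 - s) * sin (2 * \<alpha> * s))"
    unfolding moment_def
    by (intro set_lebesgue_integral_cong) (auto simp: gap_quotient[OF assms])
  moreover have "(p - 1) / (2 * (p + 1)) * ((p + 1) / 2) = (p - 1) / 4"
    using assms by (simp add: divide_simps)
  ultimately show "C12 p \<alpha> = (p - 1) / 4 * moment p (1 / 2) (\<lambda>s. sin (2 * \<alpha>) - sin (2 * \<alpha> * s))
      + (p + 1) / 4 * moment p (3 / 2) (\<lambda>s. (1 - s) * sin (2 * \<alpha> * s))"
    unfolding C12_def using assms by (simp only: mult.assoc[symmetric])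
qed

text \<open>
  Exchanging the order of integration over the triangle \<open>0 < y < s < 1\<close> leaves the inner integral of
  \<open>cos (2 \<alpha> s)\<close> over \<open>(y, 1)\<close>.  This gains the factor \<open>1 / \<alpha>\<close> and a zero of the integrand at \<open>y = 1\<close>.
\<close>

lemma C3_eq_moment:
  assumes p: "p > 1" and \<alpha>: "\<alpha> > 0"
  shows "C3 p \<alpha> = - (3 / 64) * (p + 1)\<^sup>2 / \<alpha>
    * moment p (5 / 2) (\<lambda>y. (1 - y\<^sup>2) * (sin (2 * \<alpha>) - sin (2 * \<alpha> * y)))"
proof -
  define k where "k y = (1 - y\<^sup>2) / (1 - y powr (p + 1)) powr (5 / 2)" for y
  have k_meas [measurable]: "k \<in> borel_measurable borel"
    unfolding k_def by measurable
  have k_eq: "k y = (1 - y\<^sup>2) * gap p y powr (- (5 / 2))" if "y \<in> {0<..<1}" for y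
    unfolding k_def using gap_quotient(1)[OF p that] .
  have k_nonneg: "k y \<ge> 0" if "y \<in> {0<..<1}" for y
    using that unfolding k_def by (auto simp: power_le_one intro!: divide_nonneg_nonneg)
  define T :: "(real \<times> real) set" where "T = {(y, s). 0 < y \<and> y < s \<and> s < 1}"
  have T [measurable]: "T \<in> sets (lborel \<Otimes>\<^sub>M lborel)"
  proof -
    have "open T" unfolding T_def case_prod_unfold
      by (intro open_Collect_conj open_Collect_less continuous_intros)
    then show ?thesis unfolding lborel_prod sets_lborel by (rule borel_open)
  qed
  have slice_s: "indicator T (y, s) = (indicator {0<..<1} y * indicator {y<..<1} s :: real)" for y s
    by (auto simp: T_def indicator_def)
  have slice_y: "indicator T (y, s) = (indicator {0<..<1} s * indicator {0<..<s} y :: real)" for y s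
    by (auto simp: T_def indicator_def)
  \<comment> \<open>integrating out \<open>s\<close> from the integrand without the cosine leaves a factor \<open>1 - y\<close>, enough to tame \<open>k\<close>\<close>
  have dominating: "integrable (lborel \<Otimes>\<^sub>M lborel) (\<lambda>z. indicator T z * k (fst z))"
  proof (rule lborel_pair.Fubini_integrable)
    have "(\<integral>s. norm (indicator T (y, s) * k (fst (y, s))) \<partial>lborel)
        = indicator {0<..<1} y *\<^sub>R ((1 - y\<^sup>2) * (1 - y) * gap p y powr (- (5 / 2)))" for y
    proof (cases "y \<in> {0<..<1}")
      case True
      have "(\<integral>s. norm (indicator T (y, s) * k (fst (y, s))) \<partial>lborel) = (\<integral>s. indicator {y<..<1} s * k y \<partial>lborel)"
        using True k_nonneg[OF True] unfolding slice_s by (simp add: abs_mult)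
      also have "\<dots> = (1 - y) * k y"
        using True by simp
      finally show ?thesis using True k_eq[OF True] by simp
    qed (simp add: slice_s)
    moreover have "set_integrable lborel {0<..<1} (\<lambda>y. ((1 - y\<^sup>2) * (1 - y)) * gap p y powr (- (5 / 2)))"
    proof (rule gap_moment(1)[where C = 2 and k = 2, OF p])
      show "\<bar>(1 - y\<^sup>2) * (1 - y)\<bar> \<le> 2 * (1 - y) powr 2" if "y \<in> {0<..<1}" for y :: real
      proof -
        have "\<bar>(1 - y\<^sup>2) * (1 - y)\<bar> \<le> (2 * (1 - y)) * (1 - y)"
          using one_minus_square_bounds[OF that] that unfolding abs_mult by (intro mult_mono) auto
        also have "\<dots> = 2 * (1 - y)\<^sup>2" unfolding power2_eq_square mult.assoc ..
        also have "(1 - y)\<^sup>2 = (1 - y) powr 2" using that by simp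
        finally show ?thesis .
      qed
    qed (auto intro!: continuous_intros)
    ultimately show "integrable lborel (\<lambda>y. \<integral>s. norm (indicator T (y, s) * k (fst (y, s))) \<partial>lborel)"
      by (simp add: set_integrable_def)
    have "integrable lborel (indicator {y<..<1} :: real \<Rightarrow> real)" for y :: real
      using emeasure_bounded_finite[of "{y<..<1}"] by (intro integrable_real_indicator) auto
    then show "AE y in lborel. integrable lborel (\<lambda>s. indicator T (y, s) * k (fst (y, s)))"
      unfolding slice_s fst_conv by (intro AE_I2 integrable_mult_left integrable_mult_right)
  qed measurable
  have "integrable (lborel \<Otimes>\<^sub>M lborel) (\<lambda>z. indicator T z * k (fst z) * cos (2 * \<alpha> * snd z))"
    by (rule Bochner_Integration.integrable_bound[OF dominating])
      (auto simp: abs_mult mult_left_le intro!: AE_I2)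
  then have int: "integrable (lborel \<Otimes>\<^sub>M lborel) (\<lambda>(y, s). indicator T (y, s) * k y * cos (2 * \<alpha> * s))"
    by (simp add: case_prod_unfold)
  have inner: "(LBINT s:{y<..<1}. cos (2 * \<alpha> * s)) = (sin (2 * \<alpha>) - sin (2 * \<alpha> * y)) / (2 * \<alpha>)"
    if "y \<in> {0<..<1}" for y
  proof -
    have "(LBINT s=ereal y..ereal 1. cos (2 * \<alpha> * s)) = sin (2 * \<alpha> * 1) / (2 * \<alpha>) - sin (2 * \<alpha> * y) / (2 * \<alpha>)"
      using that \<alpha> by (intro interval_integral_FTC_finite)
        (auto intro!: continuous_intros derivative_eq_intros
          simp flip: has_real_derivative_iff_has_vector_derivative)
    then show ?thesis using that by (simp add: interval_integral_Ioo diff_divide_distrib)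
  qed
  have section_y: "(\<integral>y. indicator T (y, s) * k y * cos (2 * \<alpha> * s) \<partial>lborel)
      = indicator {0<..<1} s *\<^sub>R ((LBINT y:{0<..<s}. k y) * cos (2 * \<alpha> * s))" for s
  proof -
    have "indicator T (y, s) * k y * cos (2 * \<alpha> * s)
        = (indicator {0<..<1} s * cos (2 * \<alpha> * s)) * (indicator {0<..<s} y *\<^sub>R k y)" for y
      by (simp add: slice_y)
    then show ?thesis unfolding set_lebesgue_integral_def by (simp only: integral_mult_right_zero) simp
  qed
  have section_s: "(\<integral>s. indicator T (y, s) * k y * cos (2 * \<alpha> * s) \<partial>lborel)
      = indicator {0<..<1} y *\<^sub>R (k y * (LBINT s:{y<..<1}. cos (2 * \<alpha> * s)))" for y
  proof -
    have "indicator T (y, s) * k y * cos (2 * \<alpha> * s)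
        = (indicator {0<..<1} y * k y) * (indicator {y<..<1} s *\<^sub>R cos (2 * \<alpha> * s))" for s
      by (simp add: slice_s)
    then show ?thesis unfolding set_lebesgue_integral_def by (simp only: integral_mult_right_zero) simp
  qed
  have "(LBINT s:{0<..<1}. (LBINT y:{0<..<s}. k y) * cos (2 * \<alpha> * s))
      = (\<integral>s. (\<integral>y. indicator T (y, s) * k y * cos (2 * \<alpha> * s) \<partial>lborel) \<partial>lborel)"
    unfolding section_y by (simp only: set_lebesgue_integral_def)
  also have "\<dots> = (\<integral>y. (\<integral>s. indicator T (y, s) * k y * cos (2 * \<alpha> * s) \<partial>lborel) \<partial>lborel)"
    by (rule lborel_pair.Fubini_integral[OF int])
  also have "\<dots> = (LBINT y:{0<..<1}. k y * (LBINT s:{y<..<1}. cos (2 * \<alpha> * s)))"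
    unfolding section_s by (simp only: set_lebesgue_integral_def)
  also have "\<dots> = (LBINT y:{0<..<1}. ((1 - y\<^sup>2) * (sin (2 * \<alpha>) - sin (2 * \<alpha> * y))) * gap p y powr (- (5 / 2)) / (2 * \<alpha>))"
    by (intro set_lebesgue_integral_cong) (auto simp: inner k_eq)
  finally have "(LBINT s:{0<..<1}. (LBINT y:{0<..<s}. k y) * cos (2 * \<alpha> * s))
      = moment p (5 / 2) (\<lambda>y. (1 - y\<^sup>2) * (sin (2 * \<alpha>) - sin (2 * \<alpha> * y))) / (2 * \<alpha>)"
    unfolding moment_def by simp
  then show ?thesis
    unfolding C3_def k_def by simp
qed

section \<open>Uniform second order expansion of powers of the radicand\<close>

text \<open>
  In terms of \<open>y = sqrt (1 + x)\<close> both remainders are rational and divisible by \<open>(y - 1)\<^sup>3\<close>, and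
  \<open>\<bar>y - 1\<bar> \<le> \<bar>x\<bar>\<close>.
\<close>

lemma inverse_square_root_Taylor:
  fixes x :: real
  assumes "\<bar>x\<bar> \<le> 1 / 2"
  shows "\<bar>1 / sqrt (1 + x) - (1 - x / 2 + 3 / 8 * x\<^sup>2)\<bar> \<le> 5 * \<bar>x\<bar> ^ 3"
    and "\<bar>sqrt (1 + x) - (1 + x / 2 - x\<^sup>2 / 8)\<bar> \<le> 5 * \<bar>x\<bar> ^ 3"
proof -
  define y where "y = sqrt (1 + x)"
  have y2: "y\<^sup>2 = 1 + x" and x: "x = y\<^sup>2 - 1" using assms by (auto simp: y_def)
  have "y \<ge> 7 / 10" unfolding y_def using assms by (intro real_le_rsqrt) (auto simp: power2_eq_square)
  have "y \<le> 5 / 4" unfolding y_def using assms by (intro real_le_lsqrt) (auto simp: power2_eq_square)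
  have "\<bar>x\<bar> = \<bar>y - 1\<bar> * (y + 1)"
    using \<open>y \<ge> 7 / 10\<close> square_diff_one_factored[of y] unfolding x power2_eq_square
    by (simp add: abs_mult mult.commute)
  then have "\<bar>y - 1\<bar> * 1 \<le> \<bar>x\<bar>"
    using \<open>y \<ge> 7 / 10\<close> by (simp only:) (intro mult_left_mono; simp)
  then have cube: "\<bar>y - 1\<bar> ^ 3 \<le> \<bar>x\<bar> ^ 3" by (intro power_mono) auto
  have "y\<^sup>2 \<le> (5 / 4)\<^sup>2" using \<open>y \<ge> 7 / 10\<close> \<open>y \<le> 5 / 4\<close> by (intro power_mono) auto
  then have b1: "(3 * y\<^sup>2 + 9 * y + 8) / (8 * y) \<le> 5"
    using \<open>y \<ge> 7 / 10\<close> \<open>y \<le> 5 / 4\<close> by (simp add: divide_le_eq power2_eq_square)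
  have "1 / y - (1 - x / 2 + 3 / 8 * x\<^sup>2) = - ((y - 1) ^ 3 * ((3 * y\<^sup>2 + 9 * y + 8) / (8 * y)))"
    using \<open>y \<ge> 7 / 10\<close> unfolding x by (simp add: field_simps) algebra
  then have "\<bar>1 / y - (1 - x / 2 + 3 / 8 * x\<^sup>2)\<bar> = \<bar>y - 1\<bar> ^ 3 * ((3 * y\<^sup>2 + 9 * y + 8) / (8 * y))"
    using \<open>y \<ge> 7 / 10\<close> by (simp add: abs_mult power_abs)
  also have "\<dots> \<le> \<bar>x\<bar> ^ 3 * 5"
    using cube b1 \<open>y \<ge> 7 / 10\<close> by (intro mult_mono) auto
  finally show "\<bar>1 / sqrt (1 + x) - (1 - x / 2 + 3 / 8 * x\<^sup>2)\<bar> \<le> 5 * \<bar>x\<bar> ^ 3"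
    by (simp add: y_def)
  have factored: "y - (1 + x / 2 - x\<^sup>2 / 8) = (y - 1) ^ 3 * ((y + 3) / 8)"
    unfolding x by (simp add: field_simps power2_eq_square power3_eq_cube)
  have "\<bar>y - (1 + x / 2 - x\<^sup>2 / 8)\<bar> = \<bar>y - 1\<bar> ^ 3 * ((y + 3) / 8)"
    unfolding factored using \<open>y \<ge> 7 / 10\<close> by (simp add: abs_mult power_abs)
  also have "\<dots> \<le> \<bar>x\<bar> ^ 3 * 5"
    using cube \<open>y \<le> 5 / 4\<close> \<open>y \<ge> 7 / 10\<close> by (intro mult_mono) auto
  finally show "\<bar>sqrt (1 + x) - (1 + x / 2 - x\<^sup>2 / 8)\<bar> \<le> 5 * \<bar>x\<bar> ^ 3"
    by (simp add: y_def)
qed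

text \<open>
  Treating both exponents at once lets the two integrals of the product formula share one proof.
\<close>

lemma powr_Taylor:
  fixes x :: real
  assumes "\<bar>x\<bar> \<le> 1 / 2" and "e = 1 / 2 \<or> e = - 1 / 2"
  shows "\<bar>(1 + x) powr (- e) - (1 - e * x + e * (e + 1) / 2 * x\<^sup>2)\<bar> \<le> 5 * \<bar>x\<bar> ^ 3"
  using assms(2)
proof
  assume "e = 1 / 2"
  with inverse_square_root_Taylor(1)[OF assms(1)] show ?thesis
    using assms(1) by (simp only:) (simp add: powr_minus_divide powr_half_sqrt)
next
  assume "e = - 1 / 2"
  with inverse_square_root_Taylor(2)[OF assms(1)] show ?thesis
    using assms(1) by (simp only:) (simp add: powr_half_sqrt)
qed

text \<open>
  What the radicand contains, up to the factor \<open>- (p + 1) / 4\<close>, besides \<open>1 - s\<^bsup>p+1\<^esup>\<close> and the regular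
  perturbation \<open>\<alpha>\<^bsup>1-p\<^esup> (1 - s\<^sup>2)\<close>; it comes from the trigonometric part of the potential.
\<close>

definition oscillation :: "real \<Rightarrow> real \<Rightarrow> real \<Rightarrow> real" where
  "oscillation p \<alpha> s = \<alpha> powr (- p) * (sin (2 * \<alpha>) - s * sin (2 * \<alpha> * s))
     + \<alpha> powr (- p - 1) / 2 * (cos (2 * \<alpha>) - cos (2 * \<alpha> * s))"

lemma radicand_eq:
  assumes "p > 1" and "\<alpha> > 0" and "s \<in> {0<..<1}"
  shows "radicand p \<alpha> s = gap p s + (p + 1) / 4 * (\<alpha> powr (1 - p) * (1 - s\<^sup>2) - oscillation p \<alpha> s)"
proof -
  define A where "A = \<alpha> powr (p + 1)"
  have "A > 0" using assms by (simp add: A_def)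
  have powers: "\<alpha> powr (1 - p) = \<alpha>\<^sup>2 / A" "\<alpha> powr (- p) = \<alpha> / A" "\<alpha> powr (- p - 1) = 1 / A"
    using assms powr_diff[of \<alpha> 2 "p + 1"] powr_diff[of \<alpha> 1 "p + 1"] powr_diff[of \<alpha> 0 "p + 1"]
    by (simp_all add: A_def)
  have scale: "(\<alpha> * s) powr (p + 1) = A * s powr (p + 1)"
    using assms by (simp add: A_def powr_mult)
  obtain q where q: "p + 1 = q" "q > 0" using \<open>p > 1\<close> by simp
  show ?thesis
    unfolding radicand_def oscillation_def potential_def gap_def scale powers A_def[symmetric]
    unfolding q(1) using \<open>A > 0\<close> \<open>q > 0\<close> by (simp add: field_simps power2_eq_square)
qed

lemma sin_cos_lipschitz:
  fixes x y :: real
  shows "\<bar>sin x - sin y\<bar> \<le> \<bar>x - y\<bar>" and "\<bar>cos x - cos y\<bar> \<le> \<bar>x - y\<bar>"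
  using field_differentiable_bound[of UNIV sin cos 1 x y]
    field_differentiable_bound[of UNIV cos "\<lambda>x. - sin x" 1 x y]
  by (auto intro!: derivative_eq_intros)

text \<open>
  Interpolation between a linear and a constant bound: \<open>min 1 x \<le> x powr (3 / 4)\<close>.  Here \<open>x\<close> will be
  \<open>\<alpha> (1 - s)\<close>, and the exponent below 1 is what saves a power of \<open>\<alpha>\<close>.
\<close>

lemma min_le_powr:
  fixes x C y :: real
  assumes "y \<le> C * x" and "y \<le> C" and "x \<ge> 0" and "C \<ge> 0"
  shows "y \<le> C * x powr (3 / 4)"
proof (cases "x \<le> 1")
  case True
  then have "x powr 1 \<le> x powr (3 / 4)" using assms by (intro powr_mono') auto
  then have "C * x \<le> C * x powr (3 / 4)" using assms by (intro mult_left_mono) auto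
  then show ?thesis using assms by simp
next
  case False
  then have "1 \<le> x powr (3 / 4)" by (intro ge_one_powr_ge_zero) auto
  then have "C * 1 \<le> C * x powr (3 / 4)" using assms by (intro mult_left_mono) auto
  then show ?thesis using assms by simp
qed

text \<open>
  Near \<open>s = 1\<close> the Lipschitz bound costs a factor \<open>\<alpha>\<close>, which puts the oscillation on the same level
  \<open>\<alpha>\<^bsup>1-p\<^esup>\<close> as the regular perturbation; away from 1 it is only of size \<open>\<alpha>\<^bsup>-p\<^esup>\<close>.  The last bound interpolates
  between the two and makes the oscillation negligible in second order terms.
\<close>

lemma oscillation_bounds:
  assumes "\<alpha> \<ge> 1" and "s \<in> {0<..<1}"
  shows "\<bar>sin (2 * \<alpha>) - s * sin (2 * \<alpha> * s)\<bar> \<le> 3 * \<alpha> * (1 - s)"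
    and "\<bar>cos (2 * \<alpha>) - cos (2 * \<alpha> * s)\<bar> \<le> 2 * \<alpha> * (1 - s)"
    and "\<bar>oscillation p \<alpha> s\<bar> \<le> 4 * \<alpha> powr (1 - p) * (1 - s)"
    and "\<bar>oscillation p \<alpha> s\<bar> \<le> 4 * \<alpha> powr (- p) * (\<alpha> * (1 - s)) powr (3 / 4)"
proof -
  have dist: "\<bar>2 * \<alpha> - 2 * \<alpha> * s\<bar> = 2 * \<alpha> * (1 - s)"
    using assms by (auto simp: abs_if algebra_simps)
  have "\<bar>sin (2 * \<alpha>) - s * sin (2 * \<alpha> * s)\<bar>
      \<le> \<bar>sin (2 * \<alpha>) - sin (2 * \<alpha> * s)\<bar> + \<bar>(1 - s) * sin (2 * \<alpha> * s)\<bar>"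
    using abs_triangle_ineq[of "sin (2 * \<alpha>) - sin (2 * \<alpha> * s)" "(1 - s) * sin (2 * \<alpha> * s)"]
    by (simp add: algebra_simps)
  also have "\<dots> \<le> 2 * \<alpha> * (1 - s) + (1 - s) * 1"
    using sin_cos_lipschitz(1)[of "2 * \<alpha>" "2 * \<alpha> * s"] assms unfolding dist abs_mult
    by (intro add_mono mult_mono) auto
  also have "\<dots> \<le> 3 * \<alpha> * (1 - s)"
    using assms mult_right_mono[of 1 \<alpha> "1 - s"] by (simp add: algebra_simps)
  finally show S: "\<bar>sin (2 * \<alpha>) - s * sin (2 * \<alpha> * s)\<bar> \<le> 3 * \<alpha> * (1 - s)" .
  show C: "\<bar>cos (2 * \<alpha>) - cos (2 * \<alpha> * s)\<bar> \<le> 2 * \<alpha> * (1 - s)"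
    using sin_cos_lipschitz(2)[of "2 * \<alpha>" "2 * \<alpha> * s"] by (simp only: dist)
  define w where "w = \<alpha> powr (- p)"
  have w: "w > 0" "\<alpha> powr (1 - p) = w * \<alpha>" "\<alpha> powr (- p - 1) = w / \<alpha>"
    using assms powr_add[of \<alpha> "- p" 1] powr_diff[of \<alpha> "- p" 1] by (auto simp: w_def)
  have split: "\<bar>oscillation p \<alpha> s\<bar> \<le> w * \<bar>sin (2 * \<alpha>) - s * sin (2 * \<alpha> * s)\<bar>
      + w / \<alpha> / 2 * \<bar>cos (2 * \<alpha>) - cos (2 * \<alpha> * s)\<bar>"
    unfolding oscillation_def w w_def[symmetric]
    using w assms by (intro order_trans[OF abs_triangle_ineq]) (auto simp: abs_mult)
  also have "\<dots> \<le> w * (3 * \<alpha> * (1 - s)) + w / \<alpha> / 2 * (2 * \<alpha> * (1 - s))"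
    using w assms S C by (intro add_mono mult_left_mono) auto
  also have "\<dots> = w * (1 - s) * (3 * \<alpha> + 1)"
    using assms by (simp add: field_simps)
  also have "\<dots> \<le> w * (1 - s) * (4 * \<alpha>)"
    using w assms by (intro mult_left_mono) auto
  also have "\<dots> = 4 * w * (\<alpha> * (1 - s))" by simp
  finally have lin: "\<bar>oscillation p \<alpha> s\<bar> \<le> 4 * w * (\<alpha> * (1 - s))" .
  then show "\<bar>oscillation p \<alpha> s\<bar> \<le> 4 * \<alpha> powr (1 - p) * (1 - s)"
    by (simp add: w mult.assoc)
  have "\<bar>s * sin (2 * \<alpha> * s)\<bar> \<le> 1 * 1"
    using assms unfolding abs_mult by (intro mult_mono) auto
  then have "\<bar>sin (2 * \<alpha>) - s * sin (2 * \<alpha> * s)\<bar> \<le> 2"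
    using abs_sin_le_one[of "2 * \<alpha>"] by linarith
  moreover have "\<bar>cos (2 * \<alpha>) - cos (2 * \<alpha> * s)\<bar> \<le> 2"
    using abs_cos_le_one[of "2 * \<alpha>"] abs_cos_le_one[of "2 * \<alpha> * s"] by linarith
  ultimately have "w * \<bar>sin (2 * \<alpha>) - s * sin (2 * \<alpha> * s)\<bar>
      + w / \<alpha> / 2 * \<bar>cos (2 * \<alpha>) - cos (2 * \<alpha> * s)\<bar> \<le> w * 2 + w / \<alpha> / 2 * 2"
    using w assms by (intro add_mono mult_left_mono) auto
  also have "\<dots> \<le> 4 * w"
    using w assms by (simp add: field_simps)
  finally have "\<bar>oscillation p \<alpha> s\<bar> \<le> 4 * w" using split by simp
  then show "\<bar>oscillation p \<alpha> s\<bar> \<le> 4 * \<alpha> powr (- p) * (\<alpha> * (1 - s)) powr (3 / 4)"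
    unfolding w_def[symmetric] using lin assms w by (intro min_le_powr) auto
qed

text \<open>
  For \<open>e = 1 / 2\<close> the moment of exponent \<open>e + 2 = 5 / 2\<close> needs a double zero at 1, those of exponent
  \<open>e + 1\<close> a simple one.
\<close>

lemma perturbation_terms_integrable:
  assumes "p > 1" and "\<alpha> \<ge> 1" and "e = 1 / 2 \<or> e = - 1 / 2"
  shows "set_integrable lborel {0<..<1} (\<lambda>s. (sin (2 * \<alpha>) - s * sin (2 * \<alpha> * s)) * gap p s powr (- (e + 1)))"
    and "set_integrable lborel {0<..<1} (\<lambda>s. (cos (2 * \<alpha>) - cos (2 * \<alpha> * s)) * gap p s powr (- (e + 1)))"
    and "set_integrable lborel {0<..<1} (\<lambda>s. (1 - s\<^sup>2) * gap p s powr (- (e + 1)))"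
    and "set_integrable lborel {0<..<1} (\<lambda>s. (1 - s\<^sup>2)\<^sup>2 * gap p s powr (- (e + 2)))"
    and "set_integrable lborel {0<..<1} (\<lambda>s. 1 * gap p s powr (- e))"
proof -
  have quad: "\<bar>1 - s\<^sup>2\<bar> \<le> 2 * (1 - s)" if "s \<in> {0<..<1}" for s :: real
    using one_minus_square_bounds[OF that] by simp
  have quad2: "\<bar>(1 - s\<^sup>2)\<^sup>2\<bar> \<le> 4 * (1 - s) powr 2" if "s \<in> {0<..<1}" for s :: real
  proof -
    have "\<bar>1 - s\<^sup>2\<bar>\<^sup>2 \<le> (2 * (1 - s))\<^sup>2"
      using quad[OF that] by (intro power_mono) auto
    also have "\<dots> = 4 * (1 - s) powr 2"
      using that unfolding power_mult_distrib by simp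
    finally show ?thesis by simp
  qed
  show "set_integrable lborel {0<..<1} (\<lambda>s. (sin (2 * \<alpha>) - s * sin (2 * \<alpha> * s)) * gap p s powr (- (e + 1)))"
    by (rule gap_moment(1)[where C = "3 * \<alpha>" and k = 1])
      (use assms oscillation_bounds(1)[OF \<open>\<alpha> \<ge> 1\<close>] in \<open>auto intro!: continuous_intros\<close>)
  show "set_integrable lborel {0<..<1} (\<lambda>s. (cos (2 * \<alpha>) - cos (2 * \<alpha> * s)) * gap p s powr (- (e + 1)))"
    by (rule gap_moment(1)[where C = "2 * \<alpha>" and k = 1])
      (use assms oscillation_bounds(2)[OF \<open>\<alpha> \<ge> 1\<close>] in \<open>auto intro!: continuous_intros\<close>)
  show "set_integrable lborel {0<..<1} (\<lambda>s. (1 - s\<^sup>2) * gap p s powr (- (e + 1)))"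
    by (rule gap_moment(1)[where C = 2 and k = 1])
      (use assms quad in \<open>auto intro!: continuous_intros\<close>)
  show "set_integrable lborel {0<..<1} (\<lambda>s. (1 - s\<^sup>2)\<^sup>2 * gap p s powr (- (e + 2)))"
    by (rule gap_moment(1)[where C = 4 and k = 2])
      (use assms quad2 in \<open>auto intro!: continuous_intros\<close>)
  show "set_integrable lborel {0<..<1} (\<lambda>s. 1 * gap p s powr (- e))"
    by (rule gap_moment(1)[where C = 1 and k = 0]) (use assms in auto)
qed

text \<open>
  Since the perturbation is bounded by \<open>6 c \<alpha>\<^bsup>1-p\<^esup> (1 - s)\<close> and the gap is at least \<open>1 - s\<close>, their quotient \<open>x\<close>
  is uniformly small up to \<open>s = 1\<close>, and Taylor's formula applies with the gap factored out.  In the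
  quadratic term the oscillation is dropped: it enters there multiplied by a full perturbation, and its
  interpolated bound gives the second error term.
\<close>

lemma radicand_power_pointwise:
  assumes p: "p > 1" and \<alpha>: "\<alpha> \<ge> 1" and s: "s \<in> {0<..<1}" and e: "e = 1 / 2 \<or> e = - 1 / 2"
    and c: "c = (p + 1) / 4" and small: "6 * c * \<alpha> powr (1 - p) \<le> 1 / 2"
  shows "\<bar>radicand p \<alpha> s powr (- e)
      - (gap p s powr (- e)
         - e * c * (\<alpha> powr (1 - p) * (1 - s\<^sup>2) - oscillation p \<alpha> s) * gap p s powr (- (e + 1))
         + e * (e + 1) / 2 * c\<^sup>2 * \<alpha> powr (2 * (1 - p)) * ((1 - s\<^sup>2)\<^sup>2 * gap p s powr (- (e + 2))))\<bar>
    \<le> (5 * (6 * c) ^ 3 * \<alpha> powr (3 * (1 - p)) + 32 * c\<^sup>2 * \<alpha> powr (7 / 4 - 2 * p)) * weight s"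
proof -
  define g u d x where "g = gap p s" and "u = \<alpha> powr (1 - p)"
    and "d = u * (1 - s\<^sup>2) - oscillation p \<alpha> s" and "x = c * d / g"
  have "c > 0" using p c by simp
  have "u > 0" using \<alpha> by (simp add: u_def)
  have g: "1 - s \<le> g" "g > 0" unfolding g_def using gap_bounds[OF p s] by auto
  have u_pow: "\<alpha> powr (2 * (1 - p)) = u\<^sup>2" "\<alpha> powr (3 * (1 - p)) = u ^ 3"
  proof -
    have "u powr 2 = \<alpha> powr (2 * (1 - p))" "u powr 3 = \<alpha> powr (3 * (1 - p))"
      unfolding u_def powr_powr by (simp_all add: mult.commute)
    then show "\<alpha> powr (2 * (1 - p)) = u\<^sup>2" "\<alpha> powr (3 * (1 - p)) = u ^ 3"
      using \<open>u > 0\<close> by simp_all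
  qed
  have quad: "0 \<le> 1 - s\<^sup>2" "1 - s\<^sup>2 \<le> 2 * (1 - s)"
    using one_minus_square_bounds[OF s] by auto
  have uquad: "\<bar>u * (1 - s\<^sup>2)\<bar> \<le> 2 * u * (1 - s)"
    using quad \<open>u > 0\<close> by (simp add: abs_mult)
  have osc: "\<bar>oscillation p \<alpha> s\<bar> \<le> 4 * u * (1 - s)"
    unfolding u_def by (rule oscillation_bounds(3)[OF \<alpha> s])
  have "\<bar>d\<bar> \<le> 6 * u * (1 - s)"
    using uquad osc unfolding d_def by linarith
  also have "\<dots> \<le> 6 * u * g" using g \<open>u > 0\<close> by simp
  finally have "c * \<bar>d\<bar> \<le> c * (6 * u * g)" using \<open>c > 0\<close> by simp
  then have x: "\<bar>x\<bar> \<le> 6 * c * u"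
    using g \<open>c > 0\<close> unfolding x_def by (simp add: abs_mult divide_le_eq mult_ac)
  then have x_half: "\<bar>x\<bar> \<le> 1 / 2" using small by (simp add: u_def)
  have R: "radicand p \<alpha> s = g * (1 + x)"
  proof -
    have "g * (1 + x) = g + c * d" using g by (simp add: x_def distrib_left)
    also have "\<dots> = radicand p \<alpha> s"
      using radicand_eq[OF p _ s, of \<alpha>] \<alpha> unfolding d_def g_def u_def c by simp
    finally show ?thesis ..
  qed
  have R_powr: "radicand p \<alpha> s powr (- e) = g powr (- e) * (1 + x) powr (- e)"
    using g x_half unfolding R by (intro powr_mult)
  have lower: "g powr (- e) * x = c * d * g powr (- (e + 1))"
    using g powr_add[of g "-(e+1)" 1] unfolding x_def by simp
  have lower2: "g powr (- e) * x\<^sup>2 = c\<^sup>2 * d\<^sup>2 * g powr (- (e + 2))"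
    using g powr_add[of g "-(e+2)" 2] unfolding x_def by (simp add: power_divide power_mult_distrib)
  let ?T = "1 - e * x + e * (e + 1) / 2 * x\<^sup>2"
  have first: "\<bar>radicand p \<alpha> s powr (- e) - g powr (- e) * ?T\<bar>
      \<le> 5 * (6 * c) ^ 3 * u ^ 3 * weight s"
  proof -
    have "\<bar>radicand p \<alpha> s powr (- e) - g powr (- e) * ?T\<bar> = g powr (- e) * \<bar>(1 + x) powr (- e) - ?T\<bar>"
      unfolding R_powr by (simp add: abs_mult flip: right_diff_distrib)
    also have "\<dots> \<le> weight s * (5 * (6 * c * u) ^ 3)"
    proof (intro mult_mono)
      show "g powr (- e) \<le> weight s"
        using gap_powr_le_weight[OF p s, of 0 e] e s unfolding g_def by auto
      show "\<bar>(1 + x) powr (- e) - ?T\<bar> \<le> 5 * (6 * c * u) ^ 3"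
        using powr_Taylor[OF x_half e] power_mono[OF x, of 3] by simp
    qed (auto simp: weight_def)
    finally show ?thesis by (simp add: power_mult_distrib mult_ac)
  qed
  have second: "\<bar>d\<^sup>2 - u\<^sup>2 * (1 - s\<^sup>2)\<^sup>2\<bar> * g powr (- (e + 2)) \<le> 32 * \<alpha> powr (7 / 4 - 2 * p) * weight s"
  proof -
    have "d\<^sup>2 - u\<^sup>2 * (1 - s\<^sup>2)\<^sup>2 = - oscillation p \<alpha> s * (d + u * (1 - s\<^sup>2))"
      unfolding d_def by (simp add: power2_eq_square algebra_simps)
    then have "\<bar>d\<^sup>2 - u\<^sup>2 * (1 - s\<^sup>2)\<^sup>2\<bar> = \<bar>oscillation p \<alpha> s\<bar> * \<bar>d + u * (1 - s\<^sup>2)\<bar>"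
      by (simp add: abs_mult)
    also have "\<dots> \<le> (4 * \<alpha> powr (- p) * (\<alpha> * (1 - s)) powr (3 / 4)) * (8 * u * (1 - s))"
    proof (intro mult_mono oscillation_bounds(4)[OF \<alpha> s])
      show "\<bar>d + u * (1 - s\<^sup>2)\<bar> \<le> 8 * u * (1 - s)"
        using \<open>\<bar>d\<bar> \<le> 6 * u * (1 - s)\<close> uquad by linarith
    qed auto
    also have "\<dots> = 32 * (\<alpha> powr (- p) * \<alpha> powr (3 / 4) * u) * ((1 - s) powr (3 / 4) * (1 - s))"
      using s \<alpha> by (simp add: powr_mult)
    also have "\<alpha> powr (- p) * \<alpha> powr (3 / 4) * u = \<alpha> powr (7 / 4 - 2 * p)"
      unfolding u_def by (simp flip: powr_add)
    also have "(1 - s) powr (3 / 4) * (1 - s) = (1 - s) powr (7 / 4)"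
      using s powr_add[of "1 - s" "3 / 4" 1] by simp
    finally have "\<bar>d\<^sup>2 - u\<^sup>2 * (1 - s\<^sup>2)\<^sup>2\<bar> * g powr (- (e + 2))
        \<le> 32 * \<alpha> powr (7 / 4 - 2 * p) * ((1 - s) powr (7 / 4) * g powr (- (e + 2)))"
      by (simp add: mult_right_mono flip: mult.assoc)
    also have "\<dots> \<le> 32 * \<alpha> powr (7 / 4 - 2 * p) * weight s"
      unfolding g_def using gap_powr_le_weight[OF p s, of "7 / 4" "e + 2"] e by (intro mult_left_mono) auto
    finally show ?thesis .
  qed
  have e_bound: "\<bar>e * (e + 1) / 2\<bar> \<le> 1"
    using e by (elim disjE; simp only:; simp)
  have "\<bar>e * (e + 1) / 2 * c\<^sup>2 * (d\<^sup>2 - u\<^sup>2 * (1 - s\<^sup>2)\<^sup>2) * g powr (- (e + 2))\<bar>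
      = \<bar>e * (e + 1) / 2\<bar> * (c\<^sup>2 * (\<bar>d\<^sup>2 - u\<^sup>2 * (1 - s\<^sup>2)\<^sup>2\<bar> * g powr (- (e + 2))))"
    by (simp add: abs_mult)
  also have "\<dots> \<le> 1 * (c\<^sup>2 * (32 * \<alpha> powr (7 / 4 - 2 * p) * weight s))"
    by (rule mult_mono[OF e_bound mult_left_mono[OF second]]) auto
  finally have second': "\<bar>e * (e + 1) / 2 * c\<^sup>2 * (d\<^sup>2 - u\<^sup>2 * (1 - s\<^sup>2)\<^sup>2) * g powr (- (e + 2))\<bar>
      \<le> 32 * c\<^sup>2 * \<alpha> powr (7 / 4 - 2 * p) * weight s"
    by (simp add: mult_ac)
  have T: "g powr (- e) * ?T = g powr (- e) - e * (c * d * g powr (- (e + 1)))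
      + e * (e + 1) / 2 * (c\<^sup>2 * d\<^sup>2 * g powr (- (e + 2)))"
    unfolding lower[symmetric] lower2[symmetric] by (simp add: algebra_simps)
  \<comment> \<open>adding and subtracting the part of the quadratic term that contains the oscillation\<close>
  have regroup: "A - (B - e * c * d * G + K * c\<^sup>2 * U * (S * G'))
      = (A - (B - e * (c * d * G) + K * (c\<^sup>2 * D * G'))) + K * c\<^sup>2 * (D - U * S) * G'"
    for A B G G' K U S D :: real
    by (simp add: algebra_simps)
  have "radicand p \<alpha> s powr (- e)
      - (g powr (- e) - e * c * d * g powr (- (e + 1))
         + e * (e + 1) / 2 * c\<^sup>2 * u\<^sup>2 * ((1 - s\<^sup>2)\<^sup>2 * g powr (- (e + 2))))
    = (radicand p \<alpha> s powr (- e) - g powr (- e) * ?T)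
      + e * (e + 1) / 2 * c\<^sup>2 * (d\<^sup>2 - u\<^sup>2 * (1 - s\<^sup>2)\<^sup>2) * g powr (- (e + 2))"
    unfolding T by (rule regroup)
  then have "\<bar>radicand p \<alpha> s powr (- e)
      - (g powr (- e) - e * c * d * g powr (- (e + 1))
         + e * (e + 1) / 2 * c\<^sup>2 * u\<^sup>2 * ((1 - s\<^sup>2)\<^sup>2 * g powr (- (e + 2))))\<bar>
    \<le> 5 * (6 * c) ^ 3 * u ^ 3 * weight s + 32 * c\<^sup>2 * \<alpha> powr (7 / 4 - 2 * p) * weight s"
    using first second' by linarith
  then show ?thesis
    unfolding u_pow d_def g_def u_def[symmetric] by (simp add: distrib_right)
qed

text \<open>
  The pointwise error is bounded by a multiple of the weight, whose integral is 4; hence the factor 4.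
\<close>

lemma radicand_power_integral:
  assumes p: "p > 1" and \<alpha>: "\<alpha> \<ge> 1" and e: "e = 1 / 2 \<or> e = - 1 / 2"
    and c: "c = (p + 1) / 4" and small: "6 * c * \<alpha> powr (1 - p) \<le> 1 / 2"
  shows "\<bar>(LBINT s:{0<..<1}. radicand p \<alpha> s powr (- e))
      - (moment p e (\<lambda>_. 1)
         - e * c * (\<alpha> powr (1 - p) * moment p (e + 1) (\<lambda>s. 1 - s\<^sup>2)
            - \<alpha> powr (- p) * moment p (e + 1) (\<lambda>s. sin (2 * \<alpha>) - s * sin (2 * \<alpha> * s))
            - \<alpha> powr (- p - 1) / 2 * moment p (e + 1) (\<lambda>s. cos (2 * \<alpha>) - cos (2 * \<alpha> * s)))
         + e * (e + 1) / 2 * c\<^sup>2 * \<alpha> powr (2 * (1 - p)) * moment p (e + 2) (\<lambda>s. (1 - s\<^sup>2)\<^sup>2))\<bar>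
    \<le> 4 * (5 * (6 * c) ^ 3 * \<alpha> powr (3 * (1 - p)) + 32 * c\<^sup>2 * \<alpha> powr (7 / 4 - 2 * p))"
proof -
  note int = perturbation_terms_integrable[OF p \<alpha> e]
  define L where "L s = \<alpha> powr (1 - p) * (1 - s\<^sup>2) - oscillation p \<alpha> s" for s
  have osc: "moment p (e + 1) (oscillation p \<alpha>)
      = \<alpha> powr (- p) * moment p (e + 1) (\<lambda>s. sin (2 * \<alpha>) - s * sin (2 * \<alpha> * s))
        + \<alpha> powr (- p - 1) / 2 * moment p (e + 1) (\<lambda>s. cos (2 * \<alpha>) - cos (2 * \<alpha> * s))"
    and osc_int: "set_integrable lborel {0<..<1} (\<lambda>s. oscillation p \<alpha> s * gap p s powr (- (e + 1)))"
    using moment_linear[OF int(1,2), of "\<alpha> powr (- p)" "\<alpha> powr (- p - 1) / 2"]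
    by (simp_all add: oscillation_def[abs_def])
  have L: "moment p (e + 1) L = \<alpha> powr (1 - p) * moment p (e + 1) (\<lambda>s. 1 - s\<^sup>2)
        - moment p (e + 1) (oscillation p \<alpha>)"
    and L_int: "set_integrable lborel {0<..<1} (\<lambda>s. L s * gap p s powr (- (e + 1)))"
    using moment_linear[OF int(3) osc_int, of "\<alpha> powr (1 - p)" "- 1"]
    by (simp_all add: L_def[abs_def])
  define A where "A s = 1 * gap p s powr (- e)" for s
  define B where "B s = e * c * (L s * gap p s powr (- (e + 1)))" for s
  define D where "D s = e * (e + 1) / 2 * c\<^sup>2 * \<alpha> powr (2 * (1 - p))
      * ((1 - s\<^sup>2)\<^sup>2 * gap p s powr (- (e + 2)))" for s
  have ints: "set_integrable lborel {0<..<1} A" "set_integrable lborel {0<..<1} B"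
      "set_integrable lborel {0<..<1} D"
    unfolding A_def B_def D_def using int(4,5) L_int by auto
  have "continuous_on {0<..<1} (\<lambda>s. radicand p \<alpha> s powr (- e) - (A s - B s + D s))"
  proof -
    have R: "continuous_on {0<..<1} (radicand p \<alpha>)"
      using isCont_radicand[OF p, of \<alpha>] \<alpha> by (intro continuous_at_imp_continuous_on) auto
    have "continuous_on {0<..<1} (\<lambda>s. radicand p \<alpha> s powr (- e))"
    proof (intro continuous_on_powr R continuous_on_const ballI)
      show "radicand p \<alpha> s \<noteq> 0" if "s \<in> {0<..<1}" for s
        using radicand_pos[OF p _ that, of \<alpha>] \<alpha> by simp
    qed
    note R_powr = this
    have L_cont: "continuous_on {0<..<1} (\<lambda>s. \<alpha> powr (1 - p) * (1 - s\<^sup>2) - oscillation p \<alpha> s)"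
      unfolding oscillation_def by (intro continuous_intros) (use \<alpha> in auto)
    have quad: "continuous_on {0<..<1} (\<lambda>s::real. (1 - s\<^sup>2)\<^sup>2)"
      by (intro continuous_intros)
    show ?thesis
      unfolding A_def B_def D_def L_def
      by (intro R_powr L_cont quad continuous_on_add continuous_on_diff continuous_on_mult continuous_on_const
          continuous_on_gap_powr[OF p])
  qed
  note bound = integral_bound_weight[OF this, of "5 * (6 * c) ^ 3 * \<alpha> powr (3 * (1 - p)) + 32 * c\<^sup>2 * \<alpha> powr (7 / 4 - 2 * p)"]
  have pw: "\<bar>radicand p \<alpha> s powr (- e) - (A s - B s + D s)\<bar>
      \<le> (5 * (6 * c) ^ 3 * \<alpha> powr (3 * (1 - p)) + 32 * c\<^sup>2 * \<alpha> powr (7 / 4 - 2 * p)) * weight s"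
    if "s \<in> {0<..<1}" for s
    using radicand_power_pointwise[OF p \<alpha> that e c small]
    unfolding A_def B_def D_def L_def by (simp only: mult.assoc mult_1_left)
  have main_int: "set_integrable lborel {0<..<1} (\<lambda>s. A s - B s + D s)"
    by (intro set_integral_add set_integral_diff ints)
  have "set_integrable lborel {0<..<1}
      (\<lambda>s. (radicand p \<alpha> s powr (- e) - (A s - B s + D s)) + (A s - B s + D s))"
    by (rule set_integral_add(1)[OF bound(1)[OF pw] main_int])
  then have R_int: "set_integrable lborel {0<..<1} (\<lambda>s. radicand p \<alpha> s powr (- e))" by simp
  have "(LBINT s:{0<..<1}. A s - B s + D s)
      = (LBINT s:{0<..<1}. A s) - (LBINT s:{0<..<1}. B s) + (LBINT s:{0<..<1}. D s)"
    by (simp only: set_integral_add(2)[OF set_integral_diff(1)[OF ints(1,2)] ints(3)]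
        set_integral_diff(2)[OF ints(1,2)])
  also have "\<dots> = moment p e (\<lambda>_. 1) - e * c * moment p (e + 1) L
      + e * (e + 1) / 2 * c\<^sup>2 * \<alpha> powr (2 * (1 - p)) * moment p (e + 2) (\<lambda>s. (1 - s\<^sup>2)\<^sup>2)"
    unfolding A_def B_def D_def moment_def set_integral_mult_right ..
  finally have main: "(LBINT s:{0<..<1}. A s - B s + D s) = \<dots>" .
  have "\<bar>(LBINT s:{0<..<1}. radicand p \<alpha> s powr (- e)) - (LBINT s:{0<..<1}. A s - B s + D s)\<bar>
      \<le> 4 * (5 * (6 * c) ^ 3 * \<alpha> powr (3 * (1 - p)) + 32 * c\<^sup>2 * \<alpha> powr (7 / 4 - 2 * p))"
    using bound(2)[OF pw] unfolding set_integral_diff(2)[OF R_int main_int] .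
  then show ?thesis
    unfolding main L osc diff_diff_eq .
qed

section \<open>Size of the oscillating coefficients\<close>

text \<open>
  In the moment that represents \<open>C3\<close> the difference of sines is at most \<open>2 (\<alpha> (1 - y))\<^bsup>3/4\<^esup>\<close>; with the factor
  \<open>1 / \<alpha>\<close> this tends to 0.  So \<open>C3\<close> is itself part of the error.
\<close>

lemma C3_bound:
  assumes p: "p > 1" and \<alpha>: "\<alpha> \<ge> 1"
  shows "\<bar>C3 p \<alpha>\<bar> \<le> 3 / 4 * (p + 1)\<^sup>2 * \<alpha> powr (- 1 / 4)"
proof -
  have "\<bar>moment p (5 / 2) (\<lambda>y. (1 - y\<^sup>2) * (sin (2 * \<alpha>) - sin (2 * \<alpha> * y)))\<bar> \<le> 4 * (4 * \<alpha> powr (3 / 4))"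
  proof (rule gap_moment(2)[where k = "7 / 4", OF p])
    fix y :: real assume y: "y \<in> {0<..<1}"
    have "\<bar>1 - y\<^sup>2\<bar> \<le> 2 * (1 - y)"
      using one_minus_square_bounds[OF y] by simp
    moreover have "\<bar>sin (2 * \<alpha>) - sin (2 * \<alpha> * y)\<bar> \<le> 2 * (\<alpha> * (1 - y)) powr (3 / 4)"
    proof (rule min_le_powr)
      have "\<bar>2 * \<alpha> - 2 * \<alpha> * y\<bar> = 2 * (\<alpha> * (1 - y))"
        using y \<alpha> by (auto simp: abs_if algebra_simps)
      then show "\<bar>sin (2 * \<alpha>) - sin (2 * \<alpha> * y)\<bar> \<le> 2 * (\<alpha> * (1 - y))"
        using sin_cos_lipschitz(1)[of "2 * \<alpha>" "2 * \<alpha> * y"] by simp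
      show "\<bar>sin (2 * \<alpha>) - sin (2 * \<alpha> * y)\<bar> \<le> 2"
        using abs_sin_le_one[of "2 * \<alpha>"] abs_sin_le_one[of "2 * \<alpha> * y"] by linarith
    qed (use y \<alpha> in auto)
    ultimately have "\<bar>(1 - y\<^sup>2) * (sin (2 * \<alpha>) - sin (2 * \<alpha> * y))\<bar>
        \<le> (2 * (1 - y)) * (2 * (\<alpha> * (1 - y)) powr (3 / 4))"
      unfolding abs_mult by (intro mult_mono) (use y in auto)
    also have "\<dots> = 4 * \<alpha> powr (3 / 4) * ((1 - y) * (1 - y) powr (3 / 4))"
      using y \<alpha> by (simp add: powr_mult)
    also have "(1 - y) * (1 - y) powr (3 / 4) = (1 - y) powr (7 / 4)"
      using y powr_add[of "1 - y" 1 "3 / 4"] by simp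
    finally show "\<bar>(1 - y\<^sup>2) * (sin (2 * \<alpha>) - sin (2 * \<alpha> * y))\<bar> \<le> 4 * \<alpha> powr (3 / 4) * (1 - y) powr (7 / 4)" .
  qed (auto intro!: continuous_intros)
  then have "\<bar>C3 p \<alpha>\<bar> \<le> 3 / 64 * (p + 1)\<^sup>2 / \<alpha> * (4 * (4 * \<alpha> powr (3 / 4)))"
    using \<alpha> p unfolding C3_eq_moment[OF p order_less_le_trans[OF zero_less_one \<alpha>]] abs_mult
    by (intro mult_mono) (auto simp: abs_mult)
  also have "\<dots> = 3 / 4 * (p + 1)\<^sup>2 * (\<alpha> powr (3 / 4) / \<alpha>)" by simp
  also have "\<alpha> powr (3 / 4) / \<alpha> = \<alpha> powr (- 1 / 4)"
    using \<alpha> powr_diff[of \<alpha> "3 / 4" 1] by simp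
  finally show ?thesis .
qed

lemma cosine_moment_bound:
  assumes "p > 1"
  shows "\<bar>moment p (1 / 2) (\<lambda>s. cos (2 * \<alpha>) - cos (2 * \<alpha> * s))\<bar> \<le> 8"
proof -
  have "\<bar>cos (2 * \<alpha>) - cos (2 * \<alpha> * s)\<bar> \<le> 2" for s
    using abs_cos_le_one[of "2 * \<alpha>"] abs_cos_le_one[of "2 * \<alpha> * s"] by linarith
  then have "\<bar>moment p (1 / 2) (\<lambda>s. cos (2 * \<alpha>) - cos (2 * \<alpha> * s))\<bar> \<le> 4 * 2"
    using assms by (intro gap_moment(2)[where k = 0]) (auto intro!: continuous_intros)
  then show ?thesis by simp
qed

lemma oscillating_coefficients_bounded:
  assumes p: "p > 1"
  shows "\<bar>C11 p \<alpha>\<bar> \<le> 4" and "\<bar>C12 p \<alpha>\<bar> \<le> 2 * (p - 1) + (p + 1)"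
    and "\<bar>C21 p \<alpha>\<bar> \<le> 2" and "\<bar>E2 p \<alpha>\<bar> \<le> p + 1"
proof -
  have prod: "\<bar>x * s\<bar> \<le> 1" "\<bar>s * x\<bar> \<le> 1" if "\<bar>x\<bar> \<le> 1" "s \<in> {0<..<1}" for x s :: real
    using that mult_mono[of "\<bar>x\<bar>" 1 s 1] by (auto simp: abs_mult mult.commute)
  have "\<bar>moment p (1 / 2) (\<lambda>s. cos (2 * \<alpha> * s) * s)\<bar> \<le> 4 * 1"
    using p by (intro gap_moment(2)[where k = 0]) (auto intro!: continuous_intros prod(1))
  then show "\<bar>C11 p \<alpha>\<bar> \<le> 4"
    unfolding oscillating_coefficients_as_moments[OF p] by simp
  have "\<bar>moment p (1 / 2) (\<lambda>s. sin (2 * \<alpha> * s) * s)\<bar> \<le> 4 * 1"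
    using p by (intro gap_moment(2)[where k = 0]) (auto intro!: continuous_intros prod(1))
  then show "\<bar>C21 p \<alpha>\<bar> \<le> 2"
    unfolding oscillating_coefficients_as_moments[OF p] by (simp add: abs_mult)
  have "\<bar>sin (2 * \<alpha>) - s * sin (2 * \<alpha> * s)\<bar> \<le> 2" if "s \<in> {0<..<1}" for s
    using prod(2)[OF abs_sin_le_one that, of "2 * \<alpha> * s"] abs_sin_le_one[of "2 * \<alpha>"] by linarith
  then have "\<bar>moment p (1 / 2) (\<lambda>s. sin (2 * \<alpha>) - s * sin (2 * \<alpha> * s))\<bar> \<le> 4 * 2"
    using p by (intro gap_moment(2)[where k = 0]) (auto intro!: continuous_intros)
  then have "(p + 1) / 8 * \<bar>moment p (1 / 2) (\<lambda>s. sin (2 * \<alpha>) - s * sin (2 * \<alpha> * s))\<bar> \<le> (p + 1) / 8 * 8"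
    using p by (intro mult_left_mono) auto
  then show "\<bar>E2 p \<alpha>\<bar> \<le> p + 1"
    unfolding oscillating_coefficients_as_moments[OF p] using p by (simp add: abs_mult)
  have "\<bar>sin (2 * \<alpha>) - sin (2 * \<alpha> * s)\<bar> \<le> 2" for s
    using abs_sin_le_one[of "2 * \<alpha>"] abs_sin_le_one[of "2 * \<alpha> * s"] by linarith
  then have 1: "\<bar>moment p (1 / 2) (\<lambda>s. sin (2 * \<alpha>) - sin (2 * \<alpha> * s))\<bar> \<le> 4 * 2"
    using p by (intro gap_moment(2)[where k = 0]) (auto intro!: continuous_intros)
  have 2: "\<bar>moment p (3 / 2) (\<lambda>s. (1 - s) * sin (2 * \<alpha> * s))\<bar> \<le> 4 * 1"
    using p by (intro gap_moment(2)[where k = 1])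
      (auto intro!: continuous_intros mult_left_le simp: abs_mult)
  have "\<bar>C12 p \<alpha>\<bar> \<le> (p - 1) / 4 * \<bar>moment p (1 / 2) (\<lambda>s. sin (2 * \<alpha>) - sin (2 * \<alpha> * s))\<bar>
      + (p + 1) / 4 * \<bar>moment p (3 / 2) (\<lambda>s. (1 - s) * sin (2 * \<alpha> * s))\<bar>"
    unfolding oscillating_coefficients_as_moments[OF p] using p
    by (intro order_trans[OF abs_triangle_ineq]) (simp add: abs_mult)
  also have "\<dots> \<le> (p - 1) / 4 * (4 * 2) + (p + 1) / 4 * (4 * 1)"
    using p 1 2 by (intro add_mono mult_left_mono) auto
  finally show "\<bar>C12 p \<alpha>\<bar> \<le> 2 * (p - 1) + (p + 1)" by (simp add: field_simps)
qed

section \<open>Asymptotics of the product\<close>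

text \<open>
  The oscillating first order term of the period integral has the exponent 3/2.
  Integration by parts lowers it to 1/2 and brings out a factor \<open>2 \<alpha>\<close>, which lifts the cosine moment
  \<open>C11\<close> from order \<open>\<alpha>\<^bsup>-p\<^esup>\<close> to \<open>\<alpha>\<^bsup>1-p\<^esup>\<close> and the sine moment \<open>C21\<close> from order \<open>\<alpha>\<^bsup>-p-1\<^esup>\<close> to \<open>\<alpha>\<^bsup>-p\<^esup>\<close>.  The part
  \<open>(1 - s) sin (2 \<alpha> s)\<close> is split off first, which leaves a function whose derivative is a multiple
  of \<open>cos (2 \<alpha> s)\<close>; the part split off belongs to \<open>C12\<close>.
\<close>

lemma linear_term_of_period:
  assumes p: "p > 1" and \<alpha>: "\<alpha> \<ge> 1"
  shows "(p + 1) / 8 * (\<alpha> powr (- p) * moment p (3 / 2) (\<lambda>s. sin (2 * \<alpha>) - s * sin (2 * \<alpha> * s))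
      + \<alpha> powr (- p - 1) / 2 * moment p (3 / 2) (\<lambda>s. cos (2 * \<alpha>) - cos (2 * \<alpha> * s)))
    = 1 / 2 * C11 p \<alpha> * \<alpha> powr (1 - p) + 1 / 2 * (C12 p \<alpha> + C21 p \<alpha>) * \<alpha> powr (- p)
      + (p - 1) / 16 * \<alpha> powr (- p - 1) * moment p (1 / 2) (\<lambda>s. cos (2 * \<alpha>) - cos (2 * \<alpha> * s))"
proof -
  define w where "w = \<alpha> powr (- p)"
  have w: "\<alpha> powr (1 - p) = w * \<alpha>" "w = \<alpha> powr (- p - 1) * \<alpha>"
    using \<alpha> powr_add[of \<alpha> "- p" 1] powr_add[of \<alpha> "- p - 1" 1] by (auto simp: w_def)
  have scaled: "moment p e (\<lambda>s. a * \<phi> s) = a * moment p e \<phi>" for e a \<phi>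
    unfolding moment_def by (simp add: mult.assoc)
  have sine: "(p + 1) * moment p (3 / 2) (\<lambda>s. sin (2 * \<alpha>) - sin (2 * \<alpha> * s))
      = (p - 1) * moment p (1 / 2) (\<lambda>s. sin (2 * \<alpha>) - sin (2 * \<alpha> * s)) + 4 * \<alpha> * C11 p \<alpha>"
  proof -
    have "(p + 1) * moment p (3 / 2) (\<lambda>s. sin (2 * \<alpha>) - sin (2 * \<alpha> * s))
        = (p - 1) * moment p (1 / 2) (\<lambda>s. sin (2 * \<alpha>) - sin (2 * \<alpha> * s))
          - 2 * moment p (1 / 2) (\<lambda>s. (- (2 * \<alpha>) * cos (2 * \<alpha> * s)) * s)"
      by (rule gap_integration_by_parts[where C = "2 * \<alpha>", OF p])
        (use \<alpha> in \<open>auto intro!: derivative_eq_intros continuous_intros mult_left_le simp: abs_mult\<close>)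
    then show ?thesis
      unfolding mult.assoc scaled oscillating_coefficients_as_moments(1)[OF p] by simp
  qed
  have cosine: "(p + 1) * moment p (3 / 2) (\<lambda>s. cos (2 * \<alpha>) - cos (2 * \<alpha> * s))
      = (p - 1) * moment p (1 / 2) (\<lambda>s. cos (2 * \<alpha>) - cos (2 * \<alpha> * s)) + 8 * \<alpha> * C21 p \<alpha>"
  proof -
    have "(p + 1) * moment p (3 / 2) (\<lambda>s. cos (2 * \<alpha>) - cos (2 * \<alpha> * s))
        = (p - 1) * moment p (1 / 2) (\<lambda>s. cos (2 * \<alpha>) - cos (2 * \<alpha> * s))
          - 2 * moment p (1 / 2) (\<lambda>s. ((2 * \<alpha>) * sin (2 * \<alpha> * s)) * s)"
      by (rule gap_integration_by_parts[where C = "2 * \<alpha>", OF p])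
        (use \<alpha> in \<open>auto intro!: derivative_eq_intros continuous_intros mult_left_le simp: abs_mult\<close>)
    then show ?thesis
      unfolding mult.assoc scaled oscillating_coefficients_as_moments(3)[OF p] by simp
  qed
  have lip: "\<bar>sin (2 * \<alpha>) - sin (2 * \<alpha> * s)\<bar> \<le> 2 * \<alpha> * (1 - s) powr 1" if "s \<in> {0<..<1}" for s
    using sin_cos_lipschitz(1)[of "2 * \<alpha>" "2 * \<alpha> * s"] that \<alpha>
    by (simp add: abs_if algebra_simps split: if_splits)
  have int1: "set_integrable lborel {0<..<1} (\<lambda>s. (sin (2 * \<alpha>) - sin (2 * \<alpha> * s)) * gap p s powr (- (3 / 2)))"
    by (rule gap_moment(1)[where C = "2 * \<alpha>" and k = 1, OF p _ lip])
      (auto intro!: continuous_intros)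
  have int2: "set_integrable lborel {0<..<1} (\<lambda>s. ((1 - s) * sin (2 * \<alpha> * s)) * gap p s powr (- (3 / 2)))"
    by (rule gap_moment(1)[where C = 1 and k = 1, OF p])
      (auto intro!: continuous_intros mult_left_le simp: abs_mult)
  have "moment p (3 / 2) (\<lambda>s. sin (2 * \<alpha>) - s * sin (2 * \<alpha> * s))
      = moment p (3 / 2) (\<lambda>s. sin (2 * \<alpha>) - sin (2 * \<alpha> * s)) + moment p (3 / 2) (\<lambda>s. (1 - s) * sin (2 * \<alpha> * s))"
    using moment_linear(1)[OF int1 int2, of 1 1] by (simp add: algebra_simps)
  then have "(p + 1) * moment p (3 / 2) (\<lambda>s. sin (2 * \<alpha>) - s * sin (2 * \<alpha> * s))
      = 4 * \<alpha> * C11 p \<alpha> + 4 * C12 p \<alpha>"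
    using sine unfolding oscillating_coefficients_as_moments(2)[OF p] by (simp add: algebra_simps add_divide_distrib diff_divide_distrib)
  then have "(p + 1) / 8 * (w * moment p (3 / 2) (\<lambda>s. sin (2 * \<alpha>) - s * sin (2 * \<alpha> * s)))
      = w / 8 * (4 * \<alpha> * C11 p \<alpha> + 4 * C12 p \<alpha>)" by simp
  moreover have "(p + 1) / 8 * (\<alpha> powr (- p - 1) / 2 * moment p (3 / 2) (\<lambda>s. cos (2 * \<alpha>) - cos (2 * \<alpha> * s)))
      = \<alpha> powr (- p - 1) / 16 * ((p - 1) * moment p (1 / 2) (\<lambda>s. cos (2 * \<alpha>) - cos (2 * \<alpha> * s)) + 8 * \<alpha> * C21 p \<alpha>)"
    unfolding cosine[symmetric] by simp
  ultimately have "(p + 1) / 8 * (w * moment p (3 / 2) (\<lambda>s. sin (2 * \<alpha>) - s * sin (2 * \<alpha> * s))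
      + \<alpha> powr (- p - 1) / 2 * moment p (3 / 2) (\<lambda>s. cos (2 * \<alpha>) - cos (2 * \<alpha> * s)))
    = w / 8 * (4 * \<alpha> * C11 p \<alpha> + 4 * C12 p \<alpha>) + \<alpha> powr (- p - 1) / 16
      * ((p - 1) * moment p (1 / 2) (\<lambda>s. cos (2 * \<alpha>) - cos (2 * \<alpha> * s)) + 8 * \<alpha> * C21 p \<alpha>)"
    by (simp only: distrib_left)
  also have "\<dots> = 1 / 2 * C11 p \<alpha> * (w * \<alpha>) + 1 / 2 * (C12 p \<alpha> + C21 p \<alpha>) * w
      + (p - 1) / 16 * \<alpha> powr (- p - 1) * moment p (1 / 2) (\<lambda>s. cos (2 * \<alpha>) - cos (2 * \<alpha> * s))"
    unfolding w(2) by (simp add: algebra_simps add_divide_distrib diff_divide_distrib)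
  finally show ?thesis
    unfolding w(1) w_def[symmetric] .
qed

lemma period_expansion:
  assumes p: "p > 1" and \<alpha>: "\<alpha> \<ge> 1" and c: "c = (p + 1) / 4"
    and small: "6 * c * \<alpha> powr (1 - p) \<le> 1 / 2"
  shows "\<bar>(LBINT s:{0<..<1}. 1 / sqrt (radicand p \<alpha> s))
      - (C0 p + (C1 p + 1 / 2 * C11 p \<alpha>) * \<alpha> powr (1 - p)
         + 1 / 2 * (C12 p \<alpha> + C21 p \<alpha>) * \<alpha> powr (- p) + C2 p * \<alpha> powr (2 * (1 - p)))\<bar>
    \<le> 20 * (6 * c) ^ 3 * \<alpha> powr (3 * (1 - p)) + 128 * c\<^sup>2 * \<alpha> powr (7 / 4 - 2 * p)
      + (p + 1) / 2 * \<alpha> powr (- p - 1)"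
proof -
  define I where "I = (LBINT s:{0<..<1}. 1 / sqrt (radicand p \<alpha> s))"
  define M where "M = moment p (1 / 2) (\<lambda>s. cos (2 * \<alpha>) - cos (2 * \<alpha> * s))"
  define v where "v = \<alpha> powr (- p - 1)"
  have "v > 0" using \<alpha> by (simp add: v_def)
  have "I = (LBINT s:{0<..<1}. radicand p \<alpha> s powr (- (1 / 2)))"
    unfolding I_def using radicand_pos[OF p, of \<alpha>] \<alpha>
    by (intro set_lebesgue_integral_cong) (auto simp: powr_minus_divide powr_half_sqrt less_imp_le)
  then have expansion: "\<bar>I - (moment p (1 / 2) (\<lambda>_. 1)
         - 1 / 2 * c * (\<alpha> powr (1 - p) * moment p (3 / 2) (\<lambda>s. 1 - s\<^sup>2)
            - \<alpha> powr (- p) * moment p (3 / 2) (\<lambda>s. sin (2 * \<alpha>) - s * sin (2 * \<alpha> * s))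
            - v / 2 * moment p (3 / 2) (\<lambda>s. cos (2 * \<alpha>) - cos (2 * \<alpha> * s)))
         + 3 / 8 * c\<^sup>2 * \<alpha> powr (2 * (1 - p)) * moment p (5 / 2) (\<lambda>s. (1 - s\<^sup>2)\<^sup>2))\<bar>
    \<le> 20 * (6 * c) ^ 3 * \<alpha> powr (3 * (1 - p)) + 128 * c\<^sup>2 * \<alpha> powr (7 / 4 - 2 * p)"
    using radicand_power_integral[OF p \<alpha> _ c small, of "1 / 2"] by (simp add: v_def)
  have "\<bar>(p - 1) / 16 * v * M\<bar> = (p - 1) / 16 * v * \<bar>M\<bar>"
    using p \<open>v > 0\<close> by (simp add: abs_mult)
  also have "\<dots> \<le> (p - 1) / 16 * v * 8"
    unfolding M_def using p \<open>v > 0\<close> cosine_moment_bound[OF p, of \<alpha>] by (intro mult_left_mono) auto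
  also have "\<dots> \<le> (p + 1) / 2 * v"
    using p \<open>v > 0\<close> by simp
  finally have rest: "\<bar>(p - 1) / 16 * v * M\<bar> \<le> (p + 1) / 2 * v" .
  have "moment p (1 / 2) (\<lambda>_. 1)
         - 1 / 2 * c * (\<alpha> powr (1 - p) * moment p (3 / 2) (\<lambda>s. 1 - s\<^sup>2)
            - \<alpha> powr (- p) * moment p (3 / 2) (\<lambda>s. sin (2 * \<alpha>) - s * sin (2 * \<alpha> * s))
            - v / 2 * moment p (3 / 2) (\<lambda>s. cos (2 * \<alpha>) - cos (2 * \<alpha> * s)))
         + 3 / 8 * c\<^sup>2 * \<alpha> powr (2 * (1 - p)) * moment p (5 / 2) (\<lambda>s. (1 - s\<^sup>2)\<^sup>2)
      = C0 p + C1 p * \<alpha> powr (1 - p)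
         + (p + 1) / 8 * (\<alpha> powr (- p) * moment p (3 / 2) (\<lambda>s. sin (2 * \<alpha>) - s * sin (2 * \<alpha> * s))
            + v / 2 * moment p (3 / 2) (\<lambda>s. cos (2 * \<alpha>) - cos (2 * \<alpha> * s)))
         + C2 p * \<alpha> powr (2 * (1 - p))"
    unfolding coefficients_as_moments[OF p] c power_divide
    by (simp add: algebra_simps add_divide_distrib diff_divide_distrib)
  also have "\<dots> = C0 p + (C1 p + 1 / 2 * C11 p \<alpha>) * \<alpha> powr (1 - p)
         + 1 / 2 * (C12 p \<alpha> + C21 p \<alpha>) * \<alpha> powr (- p) + C2 p * \<alpha> powr (2 * (1 - p))
         + (p - 1) / 16 * v * M"
    unfolding v_def M_def linear_term_of_period[OF p \<alpha>] distrib_right by (simp only: add_ac)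
  finally show ?thesis
    using expansion rest unfolding I_def[symmetric] v_def[symmetric] by linarith
qed

text \<open>
  Here the first order moments already have exponent 1/2 and are the coefficients themselves, up to the
  cosine part of the oscillation, which is of order \<open>\<alpha>\<^bsup>-p-1\<^esup>\<close>.
\<close>

lemma action_expansion:
  assumes p: "p > 1" and \<alpha>: "\<alpha> \<ge> 1" and c: "c = (p + 1) / 4"
    and small: "6 * c * \<alpha> powr (1 - p) \<le> 1 / 2"
  shows "\<bar>(LBINT s:{0<..<1}. sqrt (radicand p \<alpha> s))
      - (E0 p + E1 p * \<alpha> powr (1 - p) + E2 p \<alpha> * \<alpha> powr (- p) + E4 p * \<alpha> powr (2 * (1 - p)))\<bar>
    \<le> 20 * (6 * c) ^ 3 * \<alpha> powr (3 * (1 - p)) + 128 * c\<^sup>2 * \<alpha> powr (7 / 4 - 2 * p)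
      + (p + 1) / 2 * \<alpha> powr (- p - 1)"
proof -
  define I where "I = (LBINT s:{0<..<1}. sqrt (radicand p \<alpha> s))"
  define M where "M = moment p (1 / 2) (\<lambda>s. cos (2 * \<alpha>) - cos (2 * \<alpha> * s))"
  define v where "v = \<alpha> powr (- p - 1)"
  have "v > 0" using \<alpha> by (simp add: v_def)
  have "I = (LBINT s:{0<..<1}. radicand p \<alpha> s powr (- (- 1 / 2)))"
    unfolding I_def using radicand_pos[OF p, of \<alpha>] \<alpha>
    by (intro set_lebesgue_integral_cong) (auto simp: powr_half_sqrt less_imp_le)
  then have expansion: "\<bar>I - (moment p (- 1 / 2) (\<lambda>_. 1)
         + 1 / 2 * c * (\<alpha> powr (1 - p) * moment p (1 / 2) (\<lambda>s. 1 - s\<^sup>2)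
            - \<alpha> powr (- p) * moment p (1 / 2) (\<lambda>s. sin (2 * \<alpha>) - s * sin (2 * \<alpha> * s))
            - v / 2 * M)
         - 1 / 8 * c\<^sup>2 * \<alpha> powr (2 * (1 - p)) * moment p (3 / 2) (\<lambda>s. (1 - s\<^sup>2)\<^sup>2))\<bar>
    \<le> 20 * (6 * c) ^ 3 * \<alpha> powr (3 * (1 - p)) + 128 * c\<^sup>2 * \<alpha> powr (7 / 4 - 2 * p)"
    using radicand_power_integral[OF p \<alpha> _ c small, of "- 1 / 2"] by (simp add: v_def M_def)
  have "\<bar>(p + 1) / 16 * v * M\<bar> = (p + 1) / 16 * v * \<bar>M\<bar>"
    using p \<open>v > 0\<close> by (simp add: abs_mult)
  also have "\<dots> \<le> (p + 1) / 16 * v * 8"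
    unfolding M_def using p \<open>v > 0\<close> cosine_moment_bound[OF p, of \<alpha>] by (intro mult_left_mono) auto
  also have "\<dots> = (p + 1) / 2 * v" by (simp add: field_simps)
  finally have rest: "\<bar>(p + 1) / 16 * v * M\<bar> \<le> (p + 1) / 2 * v" .
  have "moment p (- 1 / 2) (\<lambda>_. 1)
         + 1 / 2 * c * (\<alpha> powr (1 - p) * moment p (1 / 2) (\<lambda>s. 1 - s\<^sup>2)
            - \<alpha> powr (- p) * moment p (1 / 2) (\<lambda>s. sin (2 * \<alpha>) - s * sin (2 * \<alpha> * s))
            - v / 2 * M)
         - 1 / 8 * c\<^sup>2 * \<alpha> powr (2 * (1 - p)) * moment p (3 / 2) (\<lambda>s. (1 - s\<^sup>2)\<^sup>2)
      = E0 p + E1 p * \<alpha> powr (1 - p) + E2 p \<alpha> * \<alpha> powr (- p) + E4 p * \<alpha> powr (2 * (1 - p))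
        - (p + 1) / 16 * v * M"
    unfolding coefficients_as_moments[OF p] oscillating_coefficients_as_moments[OF p] c power_divide
    by (simp add: algebra_simps add_divide_distrib diff_divide_distrib)
  then show ?thesis
    using expansion rest unfolding I_def[symmetric] v_def[symmetric] by linarith
qed

lemma bounded_imp_bigo_1:
  fixes f :: "real \<Rightarrow> real"
  assumes "\<And>\<alpha>. \<bar>f \<alpha>\<bar> \<le> K"
  shows "f \<in> O[at_top](\<lambda>_. 1)"
  using assms by (intro bigoI[of _ K]) auto

text \<open>
  Relative to \<open>\<alpha>\<^bsup>2(1-p)\<^esup>\<close> the three errors have exponents \<open>1 - p\<close>, \<open>-1/4\<close> and \<open>p - 3\<close>; the last one is where
  \<open>p < 3\<close> enters.
\<close>

lemma expansion_errors_smallo: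
  fixes p :: real
  assumes p: "p > 1" "p < 3" and c: "c = (p + 1) / 4"
    and bound: "\<And>\<alpha>. \<alpha> \<ge> 1 \<Longrightarrow> 6 * c * \<alpha> powr (1 - p) \<le> 1 / 2 \<Longrightarrow> \<bar>f \<alpha>\<bar>
      \<le> A * \<alpha> powr (3 * (1 - p)) + B * \<alpha> powr (7 / 4 - 2 * p) + D * \<alpha> powr (- p - 1)"
  shows "f \<in> o[at_top](\<lambda>\<alpha>. \<alpha> powr (2 * (1 - p)))"
proof (rule landau_o.big_small_trans)
  have "((\<lambda>\<alpha>. 6 * c * \<alpha> powr (1 - p)) \<longlongrightarrow> 6 * c * 0) at_top"
    using p by (intro tendsto_intros tendsto_neg_powr filterlim_ident) auto
  then have "eventually (\<lambda>\<alpha>. 6 * c * \<alpha> powr (1 - p) < 1 / 2) at_top"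
    by (rule order_tendstoD) simp
  then have "eventually (\<lambda>\<alpha>. norm (f \<alpha>)
      \<le> 1 * norm (A * \<alpha> powr (3 * (1 - p)) + B * \<alpha> powr (7 / 4 - 2 * p) + D * \<alpha> powr (- p - 1))) at_top"
    using eventually_ge_at_top[of 1]
  proof eventually_elim
    case (elim \<alpha>)
    then show ?case using bound[of \<alpha>] by simp
  qed
  then show "f \<in> O[at_top](\<lambda>\<alpha>. A * \<alpha> powr (3 * (1 - p)) + B * \<alpha> powr (7 / 4 - 2 * p) + D * \<alpha> powr (- p - 1))"
    by (rule bigoI)
  have small: "(\<lambda>\<alpha>. a * \<alpha> powr q) \<in> o[at_top](\<lambda>\<alpha>. \<alpha> powr (2 * (1 - p)))" if "q < 2 * (1 - p)" for a q :: real
    using that by (simp add: powr_smallo_iff[OF filterlim_ident])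
  show "(\<lambda>\<alpha>. A * \<alpha> powr (3 * (1 - p)) + B * \<alpha> powr (7 / 4 - 2 * p) + D * \<alpha> powr (- p - 1))
      \<in> o[at_top](\<lambda>\<alpha>. \<alpha> powr (2 * (1 - p)))"
    using p by (intro sum_in_smallo small) auto
qed

text \<open>
  Write the two factors as \<open>C0 + X u + P\<close> and \<open>E0 + E1 u + Q\<close> with \<open>u = \<alpha>\<^bsup>1-p\<^esup>\<close> and \<open>P\<close>, \<open>Q\<close> in \<open>o(u)\<close>.
  Then \<open>P Q\<close> and \<open>u\<close> times \<open>P\<close> or \<open>Q\<close> are \<open>o(u\<^sup>2)\<close>, and the remaining terms are those of \<open>G0\<close>, \<open>G1\<close>,
  \<open>G4\<close> and \<open>G2\<close>, except for the \<open>C3\<close> contained in \<open>G4\<close>, which tends to 0.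
\<close>

lemma product_expansion:
  assumes p: "p > 1" "p < 3"
  shows "(\<lambda>\<alpha>. (LBINT s:{0<..<1}. 1 / sqrt (radicand p \<alpha> s)) * (LBINT s:{0<..<1}. sqrt (radicand p \<alpha> s))
      - (G0 p + G1 p \<alpha> * \<alpha> powr (1 - p) + G4 p \<alpha> * \<alpha> powr (2 * (1 - p)) + G2 p \<alpha> * \<alpha> powr (- p)))
    \<in> o[at_top](\<lambda>\<alpha>. \<alpha> powr (2 * (1 - p)))"
proof -
  define a b where "a \<alpha> = (LBINT s:{0<..<1}. 1 / sqrt (radicand p \<alpha> s))"
    and "b \<alpha> = (LBINT s:{0<..<1}. sqrt (radicand p \<alpha> s))" for \<alpha>
  define u w :: "real \<Rightarrow> real" where "u \<alpha> = \<alpha> powr (1 - p)" and "w \<alpha> = \<alpha> powr (- p)" for \<alpha>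
  have uu: "\<alpha> powr (2 * (1 - p)) = u \<alpha> * u \<alpha>" for \<alpha>
    unfolding u_def by (simp flip: powr_add)
  define X X' where "X \<alpha> = C1 p + 1 / 2 * C11 p \<alpha>" and "X' \<alpha> = 1 / 2 * (C12 p \<alpha> + C21 p \<alpha>)" for \<alpha>
  define ea where "ea \<alpha> = a \<alpha> - (C0 p + X \<alpha> * u \<alpha> + X' \<alpha> * w \<alpha> + C2 p * (u \<alpha> * u \<alpha>))" for \<alpha>
  define eb where "eb \<alpha> = b \<alpha> - (E0 p + E1 p * u \<alpha> + E2 p \<alpha> * w \<alpha> + E4 p * (u \<alpha> * u \<alpha>))" for \<alpha>
  have ea: "ea \<in> o[at_top](\<lambda>\<alpha>. u \<alpha> * u \<alpha>)"
  proof -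
    have "\<bar>ea \<alpha>\<bar> \<le> 20 * (6 * ((p + 1) / 4)) ^ 3 * \<alpha> powr (3 * (1 - p))
        + 128 * ((p + 1) / 4)\<^sup>2 * \<alpha> powr (7 / 4 - 2 * p) + (p + 1) / 2 * \<alpha> powr (- p - 1)"
      if "\<alpha> \<ge> 1" "6 * ((p + 1) / 4) * \<alpha> powr (1 - p) \<le> 1 / 2" for \<alpha>
      using period_expansion[OF p(1) that(1) refl that(2)]
      unfolding ea_def a_def X_def X'_def w_def uu[symmetric] unfolding u_def .
    then show ?thesis unfolding uu[symmetric] by (rule expansion_errors_smallo[OF p refl])
  qed
  have eb: "eb \<in> o[at_top](\<lambda>\<alpha>. u \<alpha> * u \<alpha>)"
  proof -
    have "\<bar>eb \<alpha>\<bar> \<le> 20 * (6 * ((p + 1) / 4)) ^ 3 * \<alpha> powr (3 * (1 - p))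
        + 128 * ((p + 1) / 4)\<^sup>2 * \<alpha> powr (7 / 4 - 2 * p) + (p + 1) / 2 * \<alpha> powr (- p - 1)"
      if "\<alpha> \<ge> 1" "6 * ((p + 1) / 4) * \<alpha> powr (1 - p) \<le> 1 / 2" for \<alpha>
      using action_expansion[OF p(1) that(1) refl that(2)]
      unfolding eb_def b_def w_def uu[symmetric] unfolding u_def .
    then show ?thesis unfolding uu[symmetric] by (rule expansion_errors_smallo[OF p refl])
  qed
  have X: "X \<in> O[at_top](\<lambda>_. 1)" and X': "X' \<in> O[at_top](\<lambda>_. 1)" and E2: "E2 p \<in> O[at_top](\<lambda>_. 1)"
  proof -
    have "\<bar>X \<alpha>\<bar> \<le> \<bar>C1 p\<bar> + 2" for \<alpha>
      using oscillating_coefficients_bounded(1)[OF p(1), of \<alpha>] unfolding X_def by linarith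
    then show "X \<in> O[at_top](\<lambda>_. 1)" by (rule bounded_imp_bigo_1)
    have "\<bar>C12 p \<alpha> + C21 p \<alpha>\<bar> \<le> 2 * (p - 1) + (p + 1) + 2" for \<alpha>
      using oscillating_coefficients_bounded(2,3)[OF p(1), of \<alpha>] by linarith
    then have "\<bar>X' \<alpha>\<bar> \<le> 1 / 2 * (2 * (p - 1) + (p + 1) + 2)" for \<alpha>
      unfolding X'_def abs_mult by (intro mult_mono) auto
    then show "X' \<in> O[at_top](\<lambda>_. 1)" by (rule bounded_imp_bigo_1)
    show "E2 p \<in> O[at_top](\<lambda>_. 1)"
      using oscillating_coefficients_bounded(4)[OF p(1)] by (rule bounded_imp_bigo_1)
  qed
  have C3: "C3 p \<in> o[at_top](\<lambda>_. 1)"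
  proof (rule landau_o.big_small_trans)
    show "C3 p \<in> O[at_top](\<lambda>\<alpha>. \<alpha> powr (- 1 / 4))"
      using C3_bound[OF p(1)]
      by (intro bigoI[of _ "3 / 4 * (p + 1)\<^sup>2"] eventually_mono[OF eventually_ge_at_top[of 1]]) auto
    show "(\<lambda>\<alpha>. \<alpha> powr (- 1 / 4)) \<in> o[at_top](\<lambda>_::real. 1 :: real)"
      using tendsto_neg_powr[OF _ filterlim_ident, of "- 1 / 4"]
      by (intro smalloI_tendsto) auto
  qed
  have u1: "u \<in> o[at_top](\<lambda>_. 1)"
    unfolding u_def using tendsto_neg_powr[OF _ filterlim_ident, of "1 - p"] p
    by (intro smalloI_tendsto) auto
  have wu: "w \<in> o[at_top](u)"
    unfolding w_def u_def by (simp add: powr_smallo_iff[OF filterlim_ident])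
  have uu_u: "(\<lambda>\<alpha>. u \<alpha> * u \<alpha>) \<in> o[at_top](u)"
    using landau_o.small_big_mult[OF u1 landau_o.big_refl[of u]] by simp
  define P Q where "P \<alpha> = X' \<alpha> * w \<alpha> + C2 p * (u \<alpha> * u \<alpha>) + ea \<alpha>"
    and "Q \<alpha> = E2 p \<alpha> * w \<alpha> + E4 p * (u \<alpha> * u \<alpha>) + eb \<alpha>" for \<alpha>
  have P: "P \<in> o[at_top](u)" and Q: "Q \<in> o[at_top](u)"
  proof -
    have 1: "(\<lambda>\<alpha>. f \<alpha> * w \<alpha>) \<in> o[at_top](u)" if "f \<in> O[at_top](\<lambda>_. 1)" for f
      using landau_o.big_small_mult[OF that wu] by simp
    have 2: "(\<lambda>\<alpha>. k * (u \<alpha> * u \<alpha>)) \<in> o[at_top](u)" for k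
      using uu_u by simp
    show "P \<in> o[at_top](u)" "Q \<in> o[at_top](u)"
      unfolding P_def Q_def
      by (intro sum_in_smallo 1 2 X' E2 landau_o.small_trans[OF ea uu_u] landau_o.small_trans[OF eb uu_u])+
  qed
  have decomposition: "a \<alpha> * b \<alpha> - (G0 p + G1 p \<alpha> * u \<alpha> + G4 p \<alpha> * (u \<alpha> * u \<alpha>) + G2 p \<alpha> * w \<alpha>)
      = E0 p * ea \<alpha> + C0 p * eb \<alpha> - E0 p * (C3 p \<alpha> * (u \<alpha> * u \<alpha>))
        + u \<alpha> * (X \<alpha> * Q \<alpha> + E1 p * P \<alpha>) + P \<alpha> * Q \<alpha>" for \<alpha>
  proof -
    have "a \<alpha> = C0 p + X \<alpha> * u \<alpha> + P \<alpha>" "b \<alpha> = E0 p + E1 p * u \<alpha> + Q \<alpha>"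
      by (simp_all add: P_def Q_def ea_def eb_def)
    moreover have "G0 p + G1 p \<alpha> * u \<alpha> + G4 p \<alpha> * (u \<alpha> * u \<alpha>) + G2 p \<alpha> * w \<alpha>
        = C0 p * E0 p + (C0 p * E1 p + X \<alpha> * E0 p) * u \<alpha>
          + ((C2 p + C3 p \<alpha>) * E0 p + C0 p * E4 p + X \<alpha> * E1 p) * (u \<alpha> * u \<alpha>)
          + (X' \<alpha> * E0 p + C0 p * E2 p \<alpha>) * w \<alpha>"
      unfolding G0_def G1_def G2_def G4_def X_def X'_def by simp
    ultimately show ?thesis
      unfolding P_def Q_def by (simp add: algebra_simps)
  qed
  have "(\<lambda>\<alpha>. X \<alpha> * Q \<alpha> + E1 p * P \<alpha>) \<in> o[at_top](u)"
    using landau_o.big_small_mult[OF X Q] P by (intro sum_in_smallo) auto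
  then have "(\<lambda>\<alpha>. u \<alpha> * (X \<alpha> * Q \<alpha> + E1 p * P \<alpha>)) \<in> o[at_top](\<lambda>\<alpha>. u \<alpha> * u \<alpha>)"
    by (rule landau_o.big_small_mult[OF landau_o.big_refl])
  moreover have "(\<lambda>\<alpha>. P \<alpha> * Q \<alpha>) \<in> o[at_top](\<lambda>\<alpha>. u \<alpha> * u \<alpha>)"
    by (rule landau_o.small_mult[OF P Q])
  moreover have "(\<lambda>\<alpha>. C3 p \<alpha> * (u \<alpha> * u \<alpha>)) \<in> o[at_top](\<lambda>\<alpha>. u \<alpha> * u \<alpha>)"
    using landau_o.small_big_mult[OF C3 landau_o.big_refl] by simp
  ultimately have "(\<lambda>\<alpha>. a \<alpha> * b \<alpha> - (G0 p + G1 p \<alpha> * u \<alpha> + G4 p \<alpha> * (u \<alpha> * u \<alpha>) + G2 p \<alpha> * w \<alpha>))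
      \<in> o[at_top](\<lambda>\<alpha>. u \<alpha> * u \<alpha>)"
    unfolding decomposition using ea eb by (intro sum_in_smallo) auto
  then show ?thesis unfolding uu a_def b_def u_def w_def .
qed

text \<open>
  For \<open>p = 2\<close> the orders \<open>\<alpha>\<^bsup>-p\<^esup>\<close> and \<open>\<alpha>\<^bsup>2(1-p)\<^esup>\<close> coincide, so both parts of the theorem are instances.
\<close>

lemma gradient_norm_expansion:
  fixes p :: real and \<mu> :: "real \<Rightarrow> real" and v :: "real \<Rightarrow> real \<Rightarrow> real"
  assumes p: "p > 1" "p < 3"
    and sol: "\<And>\<alpha>. \<alpha> > 0 \<Longrightarrow> bvp_solution p (\<mu> \<alpha>) (v \<alpha>) \<and> sup_norm (v \<alpha>) = \<alpha>"
  shows "\<exists>r. r \<in> o[at_top](\<lambda>\<alpha>. \<alpha> powr (2 * (1 - p))) \<and>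
    (\<forall>\<alpha>>0. (L2_norm (deriv (v \<alpha>)))\<^sup>2 =
      4 * \<alpha>\<^sup>2 * (G0 p + G1 p \<alpha> * \<alpha> powr (1 - p) + G4 p \<alpha> * \<alpha> powr (2 * (1 - p))
        + G2 p \<alpha> * \<alpha> powr (- p) + r \<alpha>))"
proof (intro exI conjI allI impI)
  show "(\<lambda>\<alpha>. (LBINT s:{0<..<1}. 1 / sqrt (radicand p \<alpha> s)) * (LBINT s:{0<..<1}. sqrt (radicand p \<alpha> s))
      - (G0 p + G1 p \<alpha> * \<alpha> powr (1 - p) + G4 p \<alpha> * \<alpha> powr (2 * (1 - p)) + G2 p \<alpha> * \<alpha> powr (- p)))
    \<in> o[at_top](\<lambda>\<alpha>. \<alpha> powr (2 * (1 - p)))"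
    by (rule product_expansion[OF p])
  fix \<alpha> :: real assume "\<alpha> > 0"
  then have "(L2_norm (deriv (v \<alpha>)))\<^sup>2 = 4 * \<alpha>\<^sup>2 *
      ((LBINT s:{0<..<1}. 1 / sqrt (radicand p \<alpha> s)) * (LBINT s:{0<..<1}. sqrt (radicand p \<alpha> s)))"
    using sol[of \<alpha>] by (intro gradient_norm_eq_product[OF p(1)]) auto
  then show "(L2_norm (deriv (v \<alpha>)))\<^sup>2 =
      4 * \<alpha>\<^sup>2 * (G0 p + G1 p \<alpha> * \<alpha> powr (1 - p) + G4 p \<alpha> * \<alpha> powr (2 * (1 - p))
        + G2 p \<alpha> * \<alpha> powr (- p)
        + ((LBINT s:{0<..<1}. 1 / sqrt (radicand p \<alpha> s)) * (LBINT s:{0<..<1}. sqrt (radicand p \<alpha> s))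
          - (G0 p + G1 p \<alpha> * \<alpha> powr (1 - p) + G4 p \<alpha> * \<alpha> powr (2 * (1 - p)) + G2 p \<alpha> * \<alpha> powr (- p))))"
    by (simp only: add_diff_cancel_left' add_diff_eq)
qed

theorem theorem1p5:
  fixes p :: real and \<mu> :: "real \<Rightarrow> real" and v :: "real \<Rightarrow> real \<Rightarrow> real"
  assumes "p > 1"
    and "\<And>\<alpha>. \<alpha> > 0 \<Longrightarrow> bvp_solution p (\<mu> \<alpha>) (v \<alpha>) \<and> sup_norm (v \<alpha>) = \<alpha>"
  shows "(p < 2 \<longrightarrow>
           (\<exists>r. r \<in> o[at_top](\<lambda>\<alpha>. \<alpha> powr (2 * (1 - p))) \<and>
             (\<forall>\<alpha>>0. (L2_norm (deriv (v \<alpha>)))\<^sup>2 =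
                4 * \<alpha>\<^sup>2 * (G0 p + G1 p \<alpha> * \<alpha> powr (1 - p) + G4 p \<alpha> * \<alpha> powr (2 * (1 - p))
                         + G2 p \<alpha> * \<alpha> powr (- p) + r \<alpha>)))) \<and>
         (p = 2 \<longrightarrow>
           (\<exists>r. r \<in> o[at_top](\<lambda>\<alpha>. \<alpha> powr (- 2)) \<and>
             (\<forall>\<alpha>>0. (L2_norm (deriv (v \<alpha>)))\<^sup>2 =
                4 * \<alpha>\<^sup>2 * (G0 p + G1 p \<alpha> * \<alpha> powr (- 1)
                         + (G2 p \<alpha> + G4 p \<alpha>) * \<alpha> powr (- 2) + r \<alpha>))))"
proof (intro conjI impI)
  assume "p < 2"
  then show "\<exists>r. r \<in> o[at_top](\<lambda>\<alpha>. \<alpha> powr (2 * (1 - p))) \<and>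
             (\<forall>\<alpha>>0. (L2_norm (deriv (v \<alpha>)))\<^sup>2 =
                4 * \<alpha>\<^sup>2 * (G0 p + G1 p \<alpha> * \<alpha> powr (1 - p) + G4 p \<alpha> * \<alpha> powr (2 * (1 - p))
                         + G2 p \<alpha> * \<alpha> powr (- p) + r \<alpha>))"
    using assms by (intro gradient_norm_expansion) auto
next
  assume "p = 2"
  then have exponents: "2 * (1 - p) = - 2" "1 - p = - 1" "- p = - 2" by simp_all
  have regroup: "G0 p + G1 p \<alpha> * \<alpha> powr (- 1) + G4 p \<alpha> * \<alpha> powr (- 2) + G2 p \<alpha> * \<alpha> powr (- 2) + x
      = G0 p + G1 p \<alpha> * \<alpha> powr (- 1) + (G2 p \<alpha> + G4 p \<alpha>) * \<alpha> powr (- 2) + x" for \<alpha> x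
    by (simp add: distrib_right)
  have "p < 3" using \<open>p = 2\<close> by simp
  then have "\<exists>r. r \<in> o[at_top](\<lambda>\<alpha>. \<alpha> powr (2 * (1 - p))) \<and>
      (\<forall>\<alpha>>0. (L2_norm (deriv (v \<alpha>)))\<^sup>2 =
        4 * \<alpha>\<^sup>2 * (G0 p + G1 p \<alpha> * \<alpha> powr (1 - p) + G4 p \<alpha> * \<alpha> powr (2 * (1 - p))
          + G2 p \<alpha> * \<alpha> powr (- p) + r \<alpha>))"
    using assms by (intro gradient_norm_expansion) auto
  then show "\<exists>r. r \<in> o[at_top](\<lambda>\<alpha>. \<alpha> powr (- 2)) \<and>
             (\<forall>\<alpha>>0. (L2_norm (deriv (v \<alpha>)))\<^sup>2 =
                4 * \<alpha>\<^sup>2 * (G0 p + G1 p \<alpha> * \<alpha> powr (- 1)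
                         + (G2 p \<alpha> + G4 p \<alpha>) * \<alpha> powr (- 2) + r \<alpha>))"
    unfolding exponents(1) unfolding exponents(2,3) regroup .
qed

end
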